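(* Let $\mathcal{K}$ be the class of all compact spaces $K$ such that, for every totally disconnected Tychonoff space $X$, if $C_p(X,\mathbb{D})$ is Baire then $C_p(X,K)$ is Baire. Then $\mathcal{K}$ coincides with the class of $\pi$-monolithic compact spaces.
   Context: All spaces are assumed to be Tychonoff (completely regular $T_1$); in particular compact spaces are Hausdorff. $\mathbb{D}=\{0,1\}$ is the two-point discrete space. For spaces $X,Y$, $C_p(X,Y)$ denotes the set of all continuous functions from $X$ to $Y$ with the topology of pointwise convergence (i.e. the subspace topology from the product $Y^X$). A topological space is Baire if the intersection of any sequence of its open dense subsets is dense in it. A space $X$ is totally disconnected if the quasi-component of any point $x\in X$ (the intersection of all clopen subsets of $X$ containing $x$) consists of the point $x$ alone. A compact space $X$ is called $\pi$-monolithic if for any surjective continuous mapping $f:X\to K$, where $K$ is a compact metrizable space, there exists a compact metrizable subspace $T\subseteq X$ such that $f(T)=K$. *)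

theory Defs
  imports "HOL-Analysis.Analysis"
begin

definition tychonoff_space :: "'a topology \<Rightarrow> bool"
  where "tychonoff_space X \<longleftrightarrow> completely_regular_space X \<and> t1_space X"

definition compact_Hausdorff_space :: "'a topology \<Rightarrow> bool"
  where "compact_Hausdorff_space X \<longleftrightarrow> compact_space X \<and> Hausdorff_space X"

lemma compact_Hausdorff_imp_tychonoff:
  "compact_Hausdorff_space X \<Longrightarrow> tychonoff_space X"
  by (simp add: compact_Hausdorff_space_def tychonoff_space_def Hausdorff_imp_t1_space
      compact_Hausdorff_or_regular_imp_normal_space normal_imp_completely_regular_space_gen)

text \<open>Total disconnectedness is meant in the sense of quasi-components (intersections of
  clopen sets), which is stronger than having singleton connected components.\<close>

definition quasi_totally_disconnected_space :: "'a topology \<Rightarrow> bool"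
  where "quasi_totally_disconnected_space X \<longleftrightarrow>
    (\<forall>x \<in> topspace X. \<Inter> {C. closedin X C \<and> openin X C \<and> x \<in> C} = {x})"

definition Baire_space :: "'a topology \<Rightarrow> bool"
  where "Baire_space X \<longleftrightarrow>
    (\<forall>U :: nat \<Rightarrow> 'a set.
       (\<forall>n. openin X (U n) \<and> X closure_of U n = topspace X) \<longrightarrow>
       X closure_of (\<Inter>n. U n) = topspace X)"

text \<open>Functions on the carrier of \<open>X\<close> are represented as elements of
  \<open>extensional (topspace X)\<close>, in accordance with \<^const>\<open>product_topology\<close>.\<close>

definition Cp :: "'a topology \<Rightarrow> 'b topology \<Rightarrow> ('a \<Rightarrow> 'b) topology"
  where "Cp X Y = subtopology (product_topology (\<lambda>_. Y) (topspace X))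
    {f \<in> extensional (topspace X). continuous_map X Y f}"

lemma topspace_Cp:
  "topspace (Cp X Y) = {f \<in> extensional (topspace X). continuous_map X Y f}"
  by (auto simp: Cp_def PiE_def continuous_map_def)

abbreviation two_point_space :: "bool topology"
  where "two_point_space \<equiv> discrete_topology UNIV"

text \<open>The metrizable images \<open>M\<close> range over topologies on the same type as \<open>X\<close>. This is no
  restriction, since a surjective image of \<open>X\<close> has at most as many points as \<open>X\<close>; see
  \<open>pi_monolithic_spaceD\<close> below, where \<open>M\<close> lives on an arbitrary type.\<close>

definition pi_monolithic_space :: "'a topology \<Rightarrow> bool"
  where "pi_monolithic_space X \<longleftrightarrow>
    (\<forall>(M :: 'a topology) f.
       compact_space M \<and> metrizable_space M \<and> continuous_map X M f \<and>
       f ` topspace X = topspace M \<longrightarrow>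
       (\<exists>T. compactin X T \<and> metrizable_space (subtopology X T) \<and> f ` T = topspace M))"

lemma pi_monolithic_spaceD:
  fixes X :: "'a topology" and M :: "'b topology"
  assumes X: "pi_monolithic_space X"
    and M: "compact_space M" "metrizable_space M"
    and f: "continuous_map X M f" "f ` topspace X = topspace M"
  shows "\<exists>T. compactin X T \<and> metrizable_space (subtopology X T) \<and> f ` T = topspace M"
proof -
  define s where "s = inv_into (topspace X) f"
  have s: "s y \<in> topspace X" "f (s y) = y" if "y \<in> topspace M" for y
    using that f(2) by (auto simp: s_def f_inv_into_f inv_into_into)
  define M' where "M' = pullback_topology (s ` topspace M) f M"
  have top: "topspace M' = s ` topspace M"
    using s by (auto simp: M'_def topspace_pullback_topology)
  have 1: "continuous_map M' M f"
    using continuous_map_pullback[of M M id "s ` topspace M" f] by (simp add: M'_def)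
  have 2: "continuous_map M M' s"
    unfolding M'_def
  proof (rule continuous_map_pullback')
    show "continuous_map M M (f \<circ> s)"
      by (rule continuous_map_eq[of _ _ id]) (auto simp: s)
  qed auto
  have hom: "homeomorphic_maps M M' s f"
    using 1 2 s top by (auto simp: homeomorphic_maps_def)
  then have hs: "M homeomorphic_space M'"
    using homeomorphic_space_def by blast
  have "compact_space M'" "metrizable_space M'"
    using M hs homeomorphic_compact_space homeomorphic_metrizable_space by blast+
  moreover have "continuous_map X M' (s \<circ> f)"
    using f(1) 2 continuous_map_compose by blast
  moreover have "(s \<circ> f) ` topspace X = topspace M'"
    using f(2) top by (metis image_comp)
  ultimately obtain T where T: "compactin X T" "metrizable_space (subtopology X T)"
      "(s \<circ> f) ` T = topspace M'"
    using X unfolding pi_monolithic_space_def by blast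
  have "f ` T \<subseteq> topspace M"
    using compactin_subset_topspace[OF T(1)] f(2) by blast
  then have "f ` T = f ` ((s \<circ> f) ` T)"
    using s by (force simp: image_iff)
  also have "\<dots> = topspace M"
    using T(3) top s by (force simp: image_iff)
  finally show ?thesis
    using T by blast
qed

definition pi_monolithic_compacta :: "'k topology set"
  where "pi_monolithic_compacta = {K. compact_Hausdorff_space K \<and> pi_monolithic_space K}"

text \<open>Since one cannot quantify over types inside a formula, the class of compacta is relative
  to a type \<open>'x\<close> (a universe of points) on which the test spaces \<open>X\<close> live. The class can
  only shrink when \<open>'x\<close> grows, and for a small \<open>'x\<close> it is too large (over a finite type every
  test space is finite discrete). Any type with at least continuum many points
  suffices to detect that a compact space is not \<open>\<pi>\<close>-monolithic.\<close>

definition Cp_Baire_compacta :: "'x itself \<Rightarrow> 'k topology set"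
  where "Cp_Baire_compacta _ = {K. compact_Hausdorff_space K \<and>
    (\<forall>X :: 'x topology.
       tychonoff_space X \<and> quasi_totally_disconnected_space X \<and>
       Baire_space (Cp X two_point_space) \<longrightarrow> Baire_space (Cp X K))}"

end

theory Submission
  imports Defs
begin

text \<open>For totally disconnected \<open>X\<close>, baireness of \<open>Cp X 2\<close> amounts to an interpolation
  property: a prescribed pattern on disjoint finite sets is realized, on infinitely many of them, by
  one clopen set. This property passes to countable powers, hence to maps into the Cantor set. Given
  dense open sets in \<open>Cp X K\<close>, a countable closing-off argument produces a metrizable quotient
  \<open>f\<close> of \<open>K\<close> that sees enough of them; \<open>\<pi>\<close>-monolithicity yields a map \<open>h\<close> of the Cantor set
  into \<open>K\<close> such that \<open>f \<circ> h\<close> is onto and sends cylinders to sets with nonempty interior, and along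
  \<open>h\<close> the dense open sets pull back to dense sets.

  Conversely, take a set \<open>X\<close> of continuum many points in the cube \<open>2^c\<close> that projects
  onto every countable face and on whose countable subsets every function is a coordinate. Then
  \<open>Cp X 2\<close> is Baire, and if \<open>Cp X K\<close> is Baire, then for each metrizable quotient \<open>f\<close> of \<open>K\<close>
  some continuous \<open>g : X \<rightarrow> K\<close> has \<open>f \<circ> g\<close> with dense image. The map \<open>g\<close> extends to the cube, and \<open>f \<circ> g\<close>
  depends on countably many coordinates only; the image under \<open>g\<close> of the corresponding Cantor
  subcube is a metrizable compact set that \<open>f\<close> maps onto the quotient.\<close>


section \<open>Interpolation and Baire category\<close>

text \<open>Products of Baire spaces need not be Baire, so baireness of
  \<open>Cp X two_point_space\<close> alone gives no hold on maps into the Cantor set. A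
  combinatorial property that survives countable powers, and still meets countably many dense open
  sets at once, takes its place. In the first half the obstacle is that \<pi>-monolithicity answers
  one metrizable quotient at a time, while dense open sets may involve uncountably many real
  functions on \<open>K\<close>. So the quotient has to be closed off before \<open>h\<close> is
  known: refining a condition expressed in it must not lead out of it. The interiors in the images
  of cylinders then yield density of the pulled-back sets: finitely many prescribed digits still
  leave an open set of values, and a refinement inside it lifts back to \<open>h\<close> without
  touching these digits. In the second half the two demands on the test space compete: free columns
  make its clopen sets rich, free rows make every open set depend, up to closure, on countably many
  coordinates. Each prescribes entries that the other may claim; resolving this conflict is the
  point of the tags.\<close>

definition cylinder :: "'y set \<Rightarrow> ('y \<Rightarrow> 'z) \<Rightarrow> ('y \<Rightarrow> 'z) set"
  where "cylinder D t = {g. \<forall>y\<in>D. g y = t y}"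

lemma cylinder_iff: "g \<in> cylinder D t \<longleftrightarrow> (\<forall>y\<in>D. g y = t y)"
  by (simp add: cylinder_def)

lemma cylinder_self [simp]: "t \<in> cylinder D t"
  by (simp add: cylinder_def)

text \<open>One function \<open>s\<close> carries all patterns at once; as the \<open>D n\<close>
  are disjoint, their patterns can be chosen independently of each other. The finite set
  \<open>C\<close>, on which agreement is mandatory, keeps the function inside a given basic open
  set.\<close>

definition interpolating :: "'y set \<Rightarrow> ('y \<Rightarrow> bool) set \<Rightarrow> bool"
  where "interpolating Y \<F> \<longleftrightarrow>
    (\<forall>s C D. finite C \<and> C \<subseteq> Y \<and> (\<forall>n::nat. finite (D n) \<and> D n \<subseteq> Y) \<and> disjoint_family D \<longrightarrow>
      (\<exists>f\<in>\<F>. f \<in> cylinder C s \<and> infinite {n. f \<in> cylinder (D n) s}))"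

lemma interpolatingE:
  fixes D :: "nat \<Rightarrow> 'y set"
  assumes "interpolating Y \<F>" "finite C" "C \<subseteq> Y" "\<And>n. finite (D n)" "\<And>n. D n \<subseteq> Y"
    "disjoint_family D"
  obtains f where "f \<in> \<F>" "f \<in> cylinder C s" "infinite {n. f \<in> cylinder (D n) s}"
proof -
  have "\<exists>f\<in>\<F>. f \<in> cylinder C s \<and> infinite {n. f \<in> cylinder (D n) s}"
    by (rule assms(1)[unfolded interpolating_def, rule_format]) (simp add: assms)
  then show ?thesis using that by blast
qed

text \<open>Finitary form of containing a dense open subset of the cube over
  \<open>Y\<close>.\<close>

definition cylinder_dense :: "'y set \<Rightarrow> ('y \<Rightarrow> bool) set \<Rightarrow> bool"
  where "cylinder_dense Y U \<longleftrightarrow>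
    (\<forall>D t. finite D \<and> D \<subseteq> Y \<longrightarrow>
      (\<exists>E u. finite E \<and> E \<subseteq> Y \<and> u \<in> cylinder D t \<and> cylinder (D \<union> E) u \<subseteq> U))"

lemma cylinder_denseE:
  assumes "cylinder_dense Y U" "finite D" "D \<subseteq> Y"
  obtains E u where "finite E" "E \<subseteq> Y" "u \<in> cylinder D t" "cylinder (D \<union> E) u \<subseteq> U"
proof -
  have "\<exists>E u. finite E \<and> E \<subseteq> Y \<and> u \<in> cylinder D t \<and> cylinder (D \<union> E) u \<subseteq> U"
    by (rule assms(1)[unfolded cylinder_dense_def, rule_format]) (simp add: assms)
  then show ?thesis using that by blast
qed

lemma cylinder_dense_Int:
  assumes "cylinder_dense Y U" "cylinder_dense Y V"
  shows "cylinder_dense Y (U \<inter> V)"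
  unfolding cylinder_dense_def
proof (intro allI impI)
  fix D t assume D: "finite D \<and> D \<subseteq> Y"
  obtain E u where E: "finite E" "E \<subseteq> Y" "u \<in> cylinder D t" "cylinder (D \<union> E) u \<subseteq> U"
    by (rule cylinder_denseE[OF assms(1), of D t]) (use D in auto)
  obtain E' u' where E': "finite E'" "E' \<subseteq> Y" "u' \<in> cylinder (D \<union> E) u"
      "cylinder ((D \<union> E) \<union> E') u' \<subseteq> V"
    by (rule cylinder_denseE[OF assms(2), of "D \<union> E" u]) (use D E(1,2) in auto)
  have "u' \<in> cylinder D t"
    using E(3) E'(3) by (auto simp: cylinder_iff)
  moreover have "cylinder (D \<union> (E \<union> E')) u' \<subseteq> cylinder (D \<union> E) u"
    using E'(3) by (auto simp: cylinder_iff)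
  ultimately show "\<exists>E u. finite E \<and> E \<subseteq> Y \<and> u \<in> cylinder D t \<and> cylinder (D \<union> E) u \<subseteq> U \<inter> V"
    using E E' by (intro exI[of _ "E \<union> E'"] exI[of _ u']) (auto simp: Un_assoc)
qed

lemma cylinder_dense_INT_atMost:
  fixes n :: nat
  assumes "\<And>i. cylinder_dense Y (U i)"
  shows "cylinder_dense Y (\<Inter>i\<le>n. U i)"
proof (induction n)
  case (Suc n)
  then show ?case
    using cylinder_dense_Int[OF assms[of "Suc n"]] by (simp add: atMost_Suc)
qed (use assms in simp)

text \<open>The assignments to \<open>D\<close> are finitely many, so they can be treated one after another.\<close>

lemma cylinder_dense_avoiding:
  assumes U: "cylinder_dense Y U" and D: "finite D" "D \<subseteq> Y"
  shows "\<exists>E u. finite E \<and> E \<subseteq> Y - D \<and> cylinder E u \<subseteq> U"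
proof -
  have "\<exists>E u. finite E \<and> E \<subseteq> Y - D \<and> (\<forall>t\<in>T. cylinder E u \<inter> cylinder D t \<subseteq> U)"
    if "finite T" for T
    using that
  proof (induction T)
    case empty
    then show ?case by auto
  next
    case (insert t T)
    then obtain E u where E: "finite E" "E \<subseteq> Y - D" "\<forall>t\<in>T. cylinder E u \<inter> cylinder D t \<subseteq> U"
      by blast
    obtain E' u' where E': "finite E'" "E' \<subseteq> Y"
        "u' \<in> cylinder (D \<union> E) (\<lambda>y. if y \<in> D then t y else u y)"
        "cylinder ((D \<union> E) \<union> E') u' \<subseteq> U"
      by (rule cylinder_denseE[OF U, of "D \<union> E" "\<lambda>y. if y \<in> D then t y else u y"])
        (use D E in auto)
    have u': "u' y = t y" if "y \<in> D" for y
      using that E'(3) by (auto simp: cylinder_iff)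
    have u'': "u' y = u y" if "y \<in> E" for y
      using that E(2) E'(3) by (auto simp: cylinder_iff split: if_splits)
    have "cylinder ((E \<union> E') - D) u' \<subseteq> cylinder E u"
    proof
      fix g assume g: "g \<in> cylinder (E \<union> E' - D) u'"
      show "g \<in> cylinder E u"
        unfolding cylinder_iff
      proof
        fix y assume "y \<in> E"
        moreover from this have "y \<in> E \<union> E' - D" using E(2) by auto
        ultimately show "g y = u y" using g u'' by (simp add: cylinder_iff)
      qed
    qed
    moreover have "cylinder ((E \<union> E') - D) u' \<inter> cylinder D t \<subseteq> cylinder ((D \<union> E) \<union> E') u'"
    proof
      fix g assume g: "g \<in> cylinder ((E \<union> E') - D) u' \<inter> cylinder D t"
      have "g y = u' y" if "y \<in> (D \<union> E) \<union> E'" for y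
        using g u'[of y] that by (cases "y \<in> D") (simp_all add: cylinder_iff)
      then show "g \<in> cylinder ((D \<union> E) \<union> E') u'" by (simp add: cylinder_iff)
    qed
    ultimately have "\<forall>t\<in>insert t T. cylinder ((E \<union> E') - D) u' \<inter> cylinder D t \<subseteq> U"
      using E(3) E'(4) by (metis Int_mono dual_order.trans insert_iff order_refl)
    moreover have "finite ((E \<union> E') - D)" "(E \<union> E') - D \<subseteq> Y - D"
      using E E' by auto
    ultimately show ?case by blast
  qed
  moreover have "finite (PiE D (\<lambda>_. UNIV :: bool set))"
    using D by (intro finite_PiE) auto
  ultimately obtain E u where E: "finite E" "E \<subseteq> Y - D"
     "\<forall>t\<in>PiE D (\<lambda>_. UNIV). cylinder E u \<inter> cylinder D t \<subseteq> U"
    by meson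
  have "g \<in> U" if "g \<in> cylinder E u" for g
  proof -
    have "g \<in> cylinder D (restrict g D)" by (simp add: cylinder_iff)
    moreover have "restrict g D \<in> PiE D (\<lambda>_. UNIV)" by simp
    ultimately show ?thesis using E(3) that by blast
  qed
  then have "cylinder E u \<subseteq> U" by blast
  with E(1,2) show ?thesis by blast
qed

text \<open>Patterns that force membership in decreasing sets \<open>W n\<close> can be placed on
  pairwise disjoint finite sets \<open>E n\<close>, by \<open>cylinder_dense_avoiding\<close>.
  Realizing infinitely many of them is enough: a match at stage \<open>m\<close> gives membership in
  \<open>U i\<close> for all \<open>i \<le> m\<close>.\<close>

lemma interpolating_meets_cylinder_dense:
  fixes U :: "nat \<Rightarrow> ('y \<Rightarrow> bool) set"
  assumes F: "interpolating Y \<F>" and U: "\<And>n. cylinder_dense Y (U n)"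
    and C: "finite C" "C \<subseteq> Y"
  shows "\<exists>f\<in>\<F>. f \<in> cylinder C s \<and> (\<forall>n. f \<in> U n)"
proof -
  define W where "W n = (\<Inter>i\<le>n. U i)" for n
  have W: "cylinder_dense Y (W n)" for n
    unfolding W_def by (rule cylinder_dense_INT_atMost[OF U])
  define P where "P n x \<longleftrightarrow> (case x of (A, E, u) \<Rightarrow> finite A \<and> A \<subseteq> Y \<and> C \<subseteq> A \<and> E \<subseteq> A - C \<and>
     cylinder E u \<subseteq> W n)" for n :: nat and x
  define Q where "Q x x' \<longleftrightarrow> (case (x, x') of ((A, E, u), (A', E', u')) \<Rightarrow> A \<subseteq> A' \<and> E' \<inter> A = {})"
    for x x' :: "'y set \<times> 'y set \<times> ('y \<Rightarrow> bool)"
  have step: "\<exists>A' E' u'. A \<subseteq> A' \<and> P n (A', E', u') \<and> E' \<inter> A = {}"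
    if A: "finite A" "A \<subseteq> Y" "C \<subseteq> A" for A n
  proof -
    obtain E u where "finite E" "E \<subseteq> Y - A" "cylinder E u \<subseteq> W n"
      using cylinder_dense_avoiding[OF W[of n] A(1,2)] by blast
    then show ?thesis
      using A by (intro exI[of _ "A \<union> E"] exI[of _ E] exI[of _ u]) (auto simp: P_def)
  qed
  have "\<exists>x. \<forall>n. P n (x n) \<and> Q (x n) (x (Suc n))"
  proof (rule dependent_nat_choice)
    show "\<exists>x. P 0 x"
      using step[of C 0] C by (metis subset_refl)
  next
    fix x n assume "P n x"
    then obtain A E u where x: "x = (A, E, u)" "finite A" "A \<subseteq> Y" "C \<subseteq> A"
      by (auto simp: P_def)
    then show "\<exists>y. P (Suc n) y \<and> Q x y"
      using step[of A "Suc n"] by (force simp: Q_def)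
  qed
  then obtain x where x: "\<And>n. P n (x n)" "\<And>n. Q (x n) (x (Suc n))"
    by blast
  define A where "A n = fst (x n)" for n
  define E where "E n = fst (snd (x n))" for n
  define u where "u n = snd (snd (x n))" for n
  have xe: "x n = (A n, E n, u n)" for n
    by (simp add: A_def E_def u_def)
  have P: "finite (A n)" "A n \<subseteq> Y" "E n \<subseteq> A n - C"
      "cylinder (E n) (u n) \<subseteq> W n" for n
    using x(1)[of n] by (auto simp: P_def xe)
  have Q: "A n \<subseteq> A (Suc n)" "E (Suc n) \<inter> A n = {}" for n
    using x(2)[of n] by (auto simp: Q_def xe)
  have mono: "A m \<subseteq> A n" if "m \<le> n" for m n
    using lift_Suc_mono_le[of A, OF Q(1) that] .
  have lt: "E m \<inter> E n = {}" if mn: "m < n" for m n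
  proof -
    obtain k where k: "n = Suc k" "m \<le> k"
      using mn by (cases n) auto
    have "E m \<subseteq> A k" using P(3)[of m] mono[OF k(2)] by auto
    then show ?thesis using Q(2)[of k] k by auto
  qed
  have disj: "disjoint_family E"
    unfolding disjoint_family_on_def
  proof (intro ballI impI)
    fix m n :: nat assume "m \<noteq> n"
    then consider "m < n" | "n < m" by linarith
    then show "E m \<inter> E n = {}" using lt[of m n] lt[of n m] by cases auto
  qed
  \<comment> \<open>The patterns glue because the \<open>E n\<close> are disjoint; none of them
    meets \<open>C\<close>, so \<open>s\<close> survives there.\<close>
  define s' where "s' y = (if \<exists>n. y \<in> E n then u (SOME n. y \<in> E n) y else s y)" for y
  have s'E: "s' y = u n y" if "y \<in> E n" for y n
  proof -
    have "(SOME n. y \<in> E n) = n"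
    proof (intro some_equality that)
      fix m assume "y \<in> E m"
      then show "m = n" using that disj unfolding disjoint_family_on_def by blast
    qed
    then show ?thesis using that by (auto simp: s'_def)
  qed
  have s'C: "s' y = s y" if "y \<in> C" for y
  proof -
    have "y \<notin> E n" for n using that P(3)[of n] by blast
    then show ?thesis by (simp add: s'_def)
  qed
  have EA: "E n \<subseteq> A n" for n
    using P(3)[of n] by auto
  have "finite (E n)" for n
    by (rule finite_subset[OF EA P(1)])
  moreover have "E n \<subseteq> Y" for n
    by (rule order_trans[OF EA P(2)])
  ultimately obtain f where f: "f \<in> \<F>" "f \<in> cylinder C s'" "infinite {n. f \<in> cylinder (E n) s'}"
    using interpolatingE[OF F C _ _ disj] by metis
  have "f \<in> U n" for n
  proof -
    obtain m where m: "m \<ge> n" "f \<in> cylinder (E m) s'"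
      using f(3) unfolding infinite_nat_iff_unbounded_le by blast
    then have "f \<in> cylinder (E m) (u m)" using s'E by (simp add: cylinder_iff)
    then have "f \<in> W m" using P(4) by blast
    then show ?thesis using m(1) by (auto simp: W_def)
  qed
  moreover have "f \<in> cylinder C s" using f(2) s'C by (simp add: cylinder_iff)
  ultimately show ?thesis using f(1) by blast
qed

text \<open>The coordinates are chosen one after another. Each one agrees with the pattern on all
  the sets selected so far and on an infinite subset of the remaining candidates.\<close>

lemma interpolating_power:
  assumes F: "interpolating Y \<F>"
  shows "interpolating (Y \<times> (UNIV :: nat set)) {f. \<forall>i. (\<lambda>x. f (x, i)) \<in> \<F>}"
  unfolding interpolating_def
proof (intro allI impI)
  fix s :: "'a \<times> nat \<Rightarrow> bool" and C :: "('a \<times> nat) set" and D :: "nat \<Rightarrow> ('a \<times> nat) set"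
  assume "finite C \<and> C \<subseteq> Y \<times> UNIV \<and> (\<forall>n. finite (D n) \<and> D n \<subseteq> Y \<times> UNIV) \<and> disjoint_family D"
  then have C: "finite C" "C \<subseteq> Y \<times> UNIV" and D: "\<And>n. finite (D n)" "\<And>n. D n \<subseteq> Y \<times> UNIV"
      "disjoint_family D" by auto
  define Ci where "Ci i = {x. (x, i) \<in> C}" for i :: nat
  define Di where "Di i n = {x. (x, i) \<in> D n}" for i :: nat and n
  have fin: "finite {x. (x, i) \<in> B}" if "finite B" for i and B :: "('a \<times> nat) set"
    by (rule finite_subset[of _ "fst ` B"]) (use that in force)+
  define agr where "agr f i B \<longleftrightarrow> f \<in> cylinder B (\<lambda>x. s (x, i))" for f :: "'a \<Rightarrow> bool" and i B
  define P where "P i z \<longleftrightarrow> (case z of (N, J, f) \<Rightarrow> infinite N \<and> finite J \<and> J \<subseteq> N)"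
    for i :: nat and z :: "nat set \<times> nat set \<times> ('a \<Rightarrow> bool)"
  \<comment> \<open>The infinite sets \<open>N\<close> shrink and could have a finite intersection.
    The finite sets \<open>J\<close> grow strictly and stay inside every later \<open>N\<close>, so
    their union is an infinite set of indices good for all coordinates.\<close>
  define Q where "Q i z z' \<longleftrightarrow> (case (z, z') of ((N, J, f), (N', J', f')) \<Rightarrow>
      N' \<subseteq> N \<and> J \<subset> J' \<and> f' \<in> \<F> \<and> agr f' i (Ci i) \<and> (\<forall>n\<in>N'. agr f' i (Di i n)))"
    for i :: nat and z z' :: "nat set \<times> nat set \<times> ('a \<Rightarrow> bool)"
  have "\<exists>z. \<forall>i. P i (z i) \<and> Q i (z i) (z (Suc i))"
  proof (rule dependent_nat_choice)
    show "\<exists>z. P 0 z"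
      by (rule exI[of _ "(UNIV, {}, \<lambda>_. True)"]) (auto simp: P_def)
  next
    fix z i assume "P i z"
    then obtain N J f where z: "z = (N, J, f)" "infinite N" "finite J" "J \<subseteq> N"
      by (auto simp: P_def)
    define e where "e = enumerate N"
    have e: "strict_mono e" "range e = N"
      using z(2) by (auto simp: e_def strict_mono_enumerate range_enumerate)
    have inj: "inj e" using e(1) by (simp add: strict_mono_imp_inj_on)
    \<comment> \<open>The sets with index in \<open>J\<close> become part of the mandatory set; this
      is what keeps \<open>J\<close> inside the next \<open>N\<close>.\<close>
    define C' where "C' = Ci i \<union> (\<Union>n\<in>J. Di i n)"
    have C': "finite C'" "C' \<subseteq> Y"
      using C D z fin by (auto simp: C'_def Ci_def Di_def)
    have "\<forall>n. finite (Di i (e n)) \<and> Di i (e n) \<subseteq> Y"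
      using D fin by (auto simp: Di_def)
    moreover have "disjoint_family (\<lambda>n. Di i (e n))"
      unfolding disjoint_family_on_def
    proof (intro ballI impI)
      fix m n :: nat assume "m \<noteq> n"
      then have "D (e m) \<inter> D (e n) = {}"
        using D(3) inj by (auto simp: disjoint_family_on_def inj_eq)
      then show "Di i (e m) \<inter> Di i (e n) = {}" by (auto simp: Di_def)
    qed
    ultimately obtain f' where f': "f' \<in> \<F>" "f' \<in> cylinder C' (\<lambda>x. s (x, i))"
        "infinite {n. f' \<in> cylinder (Di i (e n)) (\<lambda>x. s (x, i))}"
      using F[unfolded interpolating_def, rule_format, of C' "\<lambda>n. Di i (e n)" "\<lambda>x. s (x, i)"] C' by auto
    define N' where "N' = {n\<in>N. agr f' i (Di i n)}"
    have "e ` {n. f' \<in> cylinder (Di i (e n)) (\<lambda>x. s (x, i))} \<subseteq> N'"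
      using e by (auto simp: N'_def agr_def)
    then have inf: "infinite N'"
      using f'(3) inj by (meson finite_image_iff finite_subset inj_on_subset subset_UNIV)
    then have "infinite (N' - J)" using z by simp
    then obtain n where n: "n \<in> N'" "n \<notin> J"
      by (metis Diff_iff ex_in_conv finite.emptyI)
    have JN: "J \<subseteq> N'"
      using z f'(2) by (auto simp: N'_def agr_def C'_def cylinder_iff)
    have "P (Suc i) (N', insert n J, f')"
      using inf z n JN by (auto simp: P_def)
    moreover have "Q i z (N', insert n J, f')"
      using z n f' by (auto simp: Q_def N'_def C'_def agr_def cylinder_iff)
    ultimately show "\<exists>z'. P (Suc i) z' \<and> Q i z z'" by blast
  qed
  then obtain z where z: "\<And>i. P i (z i)" "\<And>i. Q i (z i) (z (Suc i))"
    by blast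
  define N where "N i = fst (z i)" for i
  define J where "J i = fst (snd (z i))" for i
  define f where "f i = snd (snd (z i))" for i
  have ze: "z i = (N i, J i, f i)" for i
    by (simp add: N_def J_def f_def)
  have P: "finite (J i)" "J i \<subseteq> N i" for i
    using z(1)[of i] by (auto simp: P_def ze)
  have Q: "N (Suc i) \<subseteq> N i" "J i \<subset> J (Suc i)" "f (Suc i) \<in> \<F>" "agr (f (Suc i)) i (Ci i)"
      "\<And>n. n \<in> N (Suc i) \<Longrightarrow> agr (f (Suc i)) i (Di i n)" for i
    using z(2)[of i] by (auto simp: Q_def ze)
  have Nanti: "N n \<subseteq> N m" if "m \<le> n" for m n
    using lift_Suc_antimono_le[of N, OF Q(1) that] .
  have Jmono: "J m \<subseteq> J n" if "m \<le> n" for m n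
    using lift_Suc_mono_le[of J, OF psubset_imp_subset[OF Q(2)] that] .
  have card: "i \<le> card (J i)" for i
  proof (induction i)
    case (Suc i)
    have "card (J i) < card (J (Suc i))"
      using psubset_card_mono[OF P(1) Q(2)] .
    with Suc show ?case by simp
  qed simp
  have inf: "infinite (\<Union>i. J i)"
  proof
    assume fin: "finite (\<Union>i. J i)"
    have "i \<le> card (\<Union>i. J i)" for i
      using card[of i] card_mono[OF fin, of "J i"] by (meson UN_upper UNIV_I order_trans)
    then show False by (meson not_less_eq_eq order_refl)
  qed
  have agree: "agr (f (Suc i)) i (Di i n)" if "n \<in> J k" for i n k
  proof (rule Q(5))
    have "J k \<subseteq> J (max k (Suc i))" "N (max k (Suc i)) \<subseteq> N (Suc i)"
      by (auto intro!: Jmono Nanti)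
    then show "n \<in> N (Suc i)"
      using that P(2)[of "max k (Suc i)"] by auto
  qed
  \<comment> \<open>\<open>f 0\<close> is only a start value; the function chosen for coordinate
    \<open>i\<close> sits at stage \<open>Suc i\<close>.\<close>
  define F where "F = (\<lambda>(x, i). f (Suc i) x)"
  show "\<exists>f\<in>{f. \<forall>i. (\<lambda>x. f (x, i)) \<in> \<F>}. f \<in> cylinder C s \<and> infinite {n. f \<in> cylinder (D n) s}"
  proof (intro bexI[of _ F] conjI)
    show "F \<in> cylinder C s"
      using Q(4) by (auto simp: F_def agr_def Ci_def cylinder_iff)
    have "(\<Union>i. J i) \<subseteq> {n. F \<in> cylinder (D n) s}"
      using agree by (fastforce simp: F_def agr_def Di_def cylinder_iff)
    then show "infinite {n. F \<in> cylinder (D n) s}"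
      using inf finite_subset by blast
  qed (use Q in \<open>auto simp: F_def\<close>)
qed

text \<open>A countable set has only countably many finite subsets, so each round of closing off
  keeps it countable. Countably many rounds suffice, since a finite subset of the increasing union
  already appears in one of them. This plays the role of a countable elementary submodel.\<close>

lemma countable_closure:
  assumes "countable S0" and c: "\<And>F. \<lbrakk>finite F; F \<subseteq> Z\<rbrakk> \<Longrightarrow> countable (c F) \<and> c F \<subseteq> Z"
    and "S0 \<subseteq> Z"
  shows "\<exists>S. countable S \<and> S0 \<subseteq> S \<and> S \<subseteq> Z \<and> (\<forall>F. finite F \<and> F \<subseteq> S \<longrightarrow> c F \<subseteq> S)"
proof -
  define nx where "nx S = S \<union> (\<Union>F\<in>{F. finite F \<and> F \<subseteq> S}. c F)" for S
  define T where "T n = (nx ^^ n) S0" for n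
  have T: "T 0 = S0" "T (Suc n) = nx (T n)" for n
    by (auto simp: T_def)
  have ct: "countable (T n) \<and> T n \<subseteq> Z" for n
  proof (induction n)
    case 0
    then show ?case using assms by (simp add: T)
  next
    case (Suc n)
    have "countable {F. finite F \<and> F \<subseteq> T n}"
      using Suc countable_Collect_finite_subset by blast
    then have "countable (nx (T n))"
      unfolding nx_def using Suc c by (intro countable_Un countable_UN) auto
    moreover have "nx (T n) \<subseteq> Z"
      unfolding nx_def using Suc c by blast
    ultimately show ?case using T by simp
  qed
  have mono: "T m \<subseteq> T n" if "m \<le> n" for m n
    using lift_Suc_mono_le[of T m n] that by (auto simp: T nx_def)
  have fin: "\<exists>n. F \<subseteq> T n" if "finite F" "F \<subseteq> (\<Union>n. T n)" for F
    using that
  proof (induction F)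
    case (insert x F)
    then obtain n m where "F \<subseteq> T n" "x \<in> T m" by auto
    then have "insert x F \<subseteq> T (max n m)"
      using mono[of n "max n m"] mono[of m "max n m"] by auto
    then show ?case by blast
  qed auto
  show ?thesis
  proof (intro exI[of _ "\<Union>n. T n"] conjI allI impI)
    fix F assume F: "finite F \<and> F \<subseteq> (\<Union>n. T n)"
    then obtain n where "F \<subseteq> T n" using fin by blast
    then have "c F \<subseteq> T (Suc n)" using F by (auto simp: T nx_def)
    then show "c F \<subseteq> (\<Union>n. T n)" by blast
  qed (use ct T in \<open>auto intro: exI[of _ 0]\<close>)
qed


section \<open>Function spaces over totally disconnected spaces\<close>

abbreviation cantor_cube :: "('i \<Rightarrow> bool) topology"
  where "cantor_cube \<equiv> product_topology (\<lambda>_. discrete_topology UNIV) UNIV"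

lemma openin_cylinder:
  assumes "finite J"
  shows "openin cantor_cube (cylinder J c)"
proof -
  have "cylinder J c = PiE UNIV (\<lambda>i. if i \<in> J then {c i} else UNIV)"
    by (auto simp: cylinder_iff PiE_def extensional_def Pi_def split: if_splits)
  moreover have "finite {i. (if i \<in> J then {c i} else UNIV) \<noteq> UNIV}"
    by (rule finite_subset[OF _ assms]) auto
  ultimately show ?thesis
    by (auto intro!: product_topology_basis)
qed

lemma openin_cantor_cube_iff:
  "openin cantor_cube U \<longleftrightarrow> (\<forall>c\<in>U. \<exists>J. finite J \<and> cylinder J c \<subseteq> U)"
proof
  assume U: "openin cantor_cube U"
  show "\<forall>c\<in>U. \<exists>J. finite J \<and> cylinder J c \<subseteq> U"
  proof
    fix c assume "c \<in> U"
    then obtain V where V: "c \<in> PiE UNIV V" "finite {i. V i \<noteq> UNIV}" "PiE UNIV V \<subseteq> U"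
      using product_topology_open_contains_basis[OF U] by (metis topspace_discrete_topology)
    have "cylinder {i. V i \<noteq> UNIV} c \<subseteq> PiE UNIV V"
    proof
      fix d assume d: "d \<in> cylinder {i. V i \<noteq> UNIV} c"
      have "d i \<in> V i" for i
        using d V(1) by (cases "V i = UNIV") (auto simp: cylinder_iff)
      then show "d \<in> PiE UNIV V" by auto
    qed
    with V show "\<exists>J. finite J \<and> cylinder J c \<subseteq> U" by blast
  qed
next
  assume "\<forall>c\<in>U. \<exists>J. finite J \<and> cylinder J c \<subseteq> U"
  then have "\<exists>T. openin cantor_cube T \<and> c \<in> T \<and> T \<subseteq> U" if "c \<in> U" for c
    using that openin_cylinder cylinder_self by metis
  then show "openin cantor_cube U"
    using openin_subopen by blast
qed

lemma compact_space_cantor_cube: "compact_space cantor_cube"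
  by (simp add: compact_space_product_topology compact_space_discrete_topology)

lemma finite_subset_lessThan:
  assumes "finite (J :: nat set)"
  obtains n where "J \<subseteq> {..<n}"
  using assms finite_nat_iff_bounded by blast

lemma cylinder_antimono: "J \<subseteq> J' \<Longrightarrow> cylinder J' c \<subseteq> cylinder J c"
  unfolding cylinder_def by blast

lemma continuous_map_cantor_cube_iff:
  "continuous_map cantor_cube K h \<longleftrightarrow> range h \<subseteq> topspace K \<and>
    (\<forall>V c. openin K V \<and> h c \<in> V \<longrightarrow> (\<exists>J. finite J \<and> h ` cylinder J c \<subseteq> V))"
proof -
  have "openin cantor_cube {c. h c \<in> V} \<longleftrightarrow>
      (\<forall>c. h c \<in> V \<longrightarrow> (\<exists>J. finite J \<and> h ` cylinder J c \<subseteq> V))" for V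
    by (simp add: openin_cantor_cube_iff image_subset_iff_subset_vimage vimage_def)
  then show ?thesis
    unfolding continuous_map_def by auto
qed

lemma continuous_map_cantorE:
  fixes h :: "(nat \<Rightarrow> bool) \<Rightarrow> 'k"
  assumes "continuous_map cantor_cube K h" "openin K V" "h c \<in> V"
  obtains n where "h ` cylinder {..<n} c \<subseteq> V"
proof -
  obtain J where J: "finite J" "h ` cylinder J c \<subseteq> V"
    using assms unfolding continuous_map_cantor_cube_iff by blast
  then obtain n where "J \<subseteq> {..<n}" using finite_subset_lessThan by blast
  then show ?thesis using that J cylinder_antimono by blast
qed

text \<open>Otherwise the closed sets \<open>C - V\<close> have the finite intersection property,
  directedness providing a member below any finite subfamily; a common point of them would lie in
  the intersection but outside \<open>V\<close>.\<close>

lemma compact_space_directed_Inter: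
  assumes K: "compact_space K" and C: "\<And>C. C \<in> \<C> \<Longrightarrow> closedin K C" "\<C> \<noteq> {}"
    and dir: "\<And>A B. \<lbrakk>A \<in> \<C>; B \<in> \<C>\<rbrakk> \<Longrightarrow> \<exists>C\<in>\<C>. C \<subseteq> A \<inter> B"
    and V: "openin K V" "\<Inter>\<C> \<subseteq> V"
  shows "\<exists>C\<in>\<C>. C \<subseteq> V"
proof (rule ccontr)
  assume neg: "\<not> (\<exists>C\<in>\<C>. C \<subseteq> V)"
  have fin: "\<exists>C\<in>\<C>. C \<subseteq> \<Inter>\<F>" if "finite \<F>" "\<F> \<subseteq> \<C>" for \<F>
    using that
  proof (induction \<F>)
    case empty
    then show ?case using C(2) by auto
  next
    case (insert A \<F>)
    then obtain B where "B \<in> \<C>" "B \<subseteq> \<Inter>\<F>" by auto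
    moreover from this insert.prems obtain C' where "C' \<in> \<C>" "C' \<subseteq> A \<inter> B"
      using dir[of A B] by auto
    ultimately show ?case by (intro bexI[of _ C']) auto
  qed
  let ?G = "(\<lambda>C. C - V) ` \<C>"
  have cl: "\<forall>C\<in>?G. closedin K C"
    using C(1) V(1) by (auto intro: closedin_diff)
  have "\<Inter>\<F> \<noteq> {}" if F: "finite \<F>" "\<F> \<subseteq> ?G" for \<F>
  proof -
    obtain \<F>' where F': "\<F>' \<subseteq> \<C>" "finite \<F>'" "\<F> = (\<lambda>C. C - V) ` \<F>'"
      using finite_subset_image[OF F] by blast
    obtain C' where C': "C' \<in> \<C>" "C' \<subseteq> \<Inter>\<F>'" using fin F' by blast
    then have "C' - V \<subseteq> \<Inter>\<F>" "C' - V \<noteq> {}" using F'(3) neg by auto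
    then show ?thesis by blast
  qed
  then have "\<Inter>?G \<noteq> {}"
    using cl by (intro K[unfolded compact_space_fip, rule_format]) simp
  then show False using V(2) C(2) by auto
qed

section \<open>Continuous maps with prescribed values at finitely many points\<close>

lemma clopen_separating_finite:
  assumes X: "quasi_totally_disconnected_space X" and "finite D" "D \<subseteq> topspace X"
    and a: "a \<in> topspace X" "a \<notin> D"
  shows "\<exists>C. closedin X C \<and> openin X C \<and> a \<in> C \<and> C \<inter> D = {}"
  using assms(2-3,5)
proof (induction D)
  case empty
  then show ?case using a by (intro exI[of _ "topspace X"]) auto
next
  case (insert d D)
  then obtain C where C: "closedin X C" "openin X C" "a \<in> C" "C \<inter> D = {}" by auto
  have "d \<notin> \<Inter> {C. closedin X C \<and> openin X C \<and> a \<in> C}"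
    using X a insert.prems unfolding quasi_totally_disconnected_space_def by auto
  then obtain C' where C': "closedin X C'" "openin X C'" "a \<in> C'" "d \<notin> C'" by auto
  show ?case
    using C C' by (intro exI[of _ "C \<inter> C'"]) auto
qed

lemma continuous_map_if_clopen:
  assumes C: "closedin X C" "openin X C" and f: "continuous_map X Y f" and g: "continuous_map X Y g"
  shows "continuous_map X Y (\<lambda>x. if x \<in> C then f x else g x)"
  unfolding continuous_map_def
proof (intro conjI allI impI)
  show "(\<lambda>x. if x \<in> C then f x else g x) \<in> topspace X \<rightarrow> topspace Y"
    using f g by (auto simp: continuous_map_def Pi_iff)
  fix U assume U: "openin Y U"
  have "{x \<in> topspace X. (if x \<in> C then f x else g x) \<in> U} =
      C \<inter> {x \<in> topspace X. f x \<in> U} \<union> ({x \<in> topspace X. g x \<in> U} - C)"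
    using openin_subset[OF C(2)] by auto
  moreover have "openin X \<dots>"
    using C U f g by (intro openin_Un openin_Int openin_diff) (auto simp: continuous_map_def)
  ultimately show "openin X {x \<in> topspace X. (if x \<in> C then f x else g x) \<in> U}" by simp
qed

text \<open>Each new value is pasted in on a clopen set around the new point that misses the earlier
  ones. The point \<open>k\<close> supplies the constant map at the start.\<close>

lemma continuous_extension_finite:
  assumes X: "quasi_totally_disconnected_space X" and "finite D" "D \<subseteq> topspace X"
    and "\<And>x. x \<in> D \<Longrightarrow> t x \<in> topspace K" and k: "k \<in> topspace K"
  shows "\<exists>g. continuous_map X K g \<and> (\<forall>x\<in>D. g x = t x)"
  using assms(2-4)
proof (induction D)
  case empty
  then show ?case using k by (intro exI[of _ "\<lambda>_. k"]) auto
next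
  case (insert a D)
  then obtain g where g: "continuous_map X K g" "\<forall>x\<in>D. g x = t x" by auto
  obtain C where C: "closedin X C" "openin X C" "a \<in> C" "C \<inter> D = {}"
    using clopen_separating_finite[OF X, of D a] insert by auto
  have "continuous_map X K (\<lambda>x. if x \<in> C then t a else g x)"
    using insert.prems by (intro continuous_map_if_clopen C g) auto
  moreover have "\<forall>x\<in>insert a D. (if x \<in> C then t a else g x) = t x"
    using C g by auto
  ultimately show ?case by blast
qed

lemma Cp_extension_finite:
  assumes X: "quasi_totally_disconnected_space X" and D: "finite D" "D \<subseteq> topspace X"
    and "\<And>x. x \<in> D \<Longrightarrow> t x \<in> topspace K" and "k \<in> topspace K"
  shows "\<exists>g\<in>topspace (Cp X K). \<forall>x\<in>D. g x = t x"
proof -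
  obtain g where g: "continuous_map X K g" "\<forall>x\<in>D. g x = t x"
    using continuous_extension_finite[OF X D, of t K k] assms(4,5) by blast
  then have "restrict g (topspace X) \<in> topspace (Cp X K)"
    by (simp add: topspace_Cp continuous_map_eq)
  moreover have "\<forall>x\<in>D. restrict g (topspace X) x = t x" using g D by auto
  ultimately show ?thesis by blast
qed

section \<open>Basic open sets of the function space\<close>

definition Cp_box :: "'a topology \<Rightarrow> 'b topology \<Rightarrow> 'a set \<Rightarrow> ('a \<Rightarrow> 'b set) \<Rightarrow> ('a \<Rightarrow> 'b) set"
  where "Cp_box X Y D V = {f \<in> topspace (Cp X Y). \<forall>x\<in>D. f x \<in> V x}"

lemma openin_Cp_box:
  assumes "finite D" "D \<subseteq> topspace X" "\<And>x. x \<in> D \<Longrightarrow> openin Y (V x)"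
  shows "openin (Cp X Y) (Cp_box X Y D V)"
proof -
  let ?W = "PiE (topspace X) (\<lambda>x. if x \<in> D then V x else topspace Y)"
  have "openin (product_topology (\<lambda>_. Y) (topspace X)) ?W"
    using assms by (intro product_topology_basis)
      (auto intro: finite_subset[of _ D])
  moreover have "Cp_box X Y D V = ?W \<inter> topspace (Cp X Y)"
    using assms(2) by (auto simp: Cp_box_def topspace_Cp PiE_def continuous_map_def Pi_iff split: if_splits)
  ultimately show ?thesis
    unfolding Cp_def topspace_Cp[unfolded Cp_def] by (simp add: openin_subtopology_Int)
qed

lemma openin_Cp_contains_box:
  assumes U: "openin (Cp X Y) U" and f: "f \<in> U"
  obtains D V where "finite D" "D \<subseteq> topspace X" "\<forall>x\<in>D. openin Y (V x)"
    "f \<in> Cp_box X Y D V" "Cp_box X Y D V \<subseteq> U"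
proof -
  let ?C = "{f \<in> extensional (topspace X). continuous_map X Y f}"
  obtain W where W: "openin (product_topology (\<lambda>_. Y) (topspace X)) W" "U = W \<inter> ?C"
    using U unfolding Cp_def openin_subtopology by blast
  obtain V where V: "f \<in> PiE (topspace X) V" "\<And>x. openin Y (V x)"
      "finite {x. V x \<noteq> topspace Y}" "PiE (topspace X) V \<subseteq> W"
    using product_topology_open_contains_basis[OF W(1), of f] f W(2) by auto
  let ?D = "{x \<in> topspace X. V x \<noteq> topspace Y}"
  show ?thesis
  proof (rule that[of ?D V])
    show "finite ?D" by (rule finite_subset[OF _ V(3)]) auto
    show "f \<in> Cp_box X Y ?D V"
      using V(1) W(2) f by (auto simp: Cp_box_def topspace_Cp)
    show "Cp_box X Y ?D V \<subseteq> U"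
    proof
      fix g assume g: "g \<in> Cp_box X Y ?D V"
      then have gC: "g \<in> ?C" by (simp add: Cp_box_def topspace_Cp)
      have "g x \<in> V x" if "x \<in> topspace X" for x
        using g gC that by (cases "V x = topspace Y") (auto simp: Cp_box_def continuous_map_def)
      then have "g \<in> PiE (topspace X) V" using gC by (simp add: PiE_iff)
      then show "g \<in> U" using V(4) W(2) gC by blast
    qed
  qed (use V in auto)
qed

text \<open>The functions that match \<open>s\<close> on some \<open>D n\<close> with
  \<open>n \<ge> m\<close> form an open set. It is dense: a basic open set constrains finitely many
  points, and by disjointness all but finitely many \<open>D n\<close> avoid them. A function in all
  these sets and in the open set given by \<open>C\<close> is the one required.\<close>

lemma Baire_Cp_imp_interpolating:
  assumes X: "quasi_totally_disconnected_space X" and B: "Baire_space (Cp X two_point_space)"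
  shows "interpolating (topspace X) {f. continuous_map X two_point_space f}"
  unfolding interpolating_def
proof (intro allI impI)
  fix s :: "'a \<Rightarrow> bool" and C :: "'a set" and D :: "nat \<Rightarrow> 'a set"
  assume "finite C \<and> C \<subseteq> topspace X \<and> (\<forall>n. finite (D n) \<and> D n \<subseteq> topspace X) \<and> disjoint_family D"
  then have C: "finite C" "C \<subseteq> topspace X"
    and D: "\<And>n. finite (D n)" "\<And>n. D n \<subseteq> topspace X" "disjoint_family D" by auto
  let ?Cp = "Cp X two_point_space"
  define W where "W E = Cp_box X two_point_space E (\<lambda>x. {s x})" for E
  define U where "U m = (\<Union>n\<in>{m..}. W (D n))" for m
  have W: "openin ?Cp (W E)" if "finite E" "E \<subseteq> topspace X" for E
    unfolding W_def using that by (intro openin_Cp_box) auto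
  have U: "openin ?Cp (U m)" for m
    unfolding U_def using W D by (intro openin_Union) auto
  have ext: "\<exists>f\<in>topspace ?Cp. \<forall>x\<in>E. f x = t x" if "finite E" "E \<subseteq> topspace X" for E t
    by (rule Cp_extension_finite[OF X that, of t two_point_space True]) auto
  have dense: "?Cp closure_of (U m) = topspace ?Cp" for m
    unfolding dense_intersects_open
  proof (intro allI impI)
    fix T assume T: "openin ?Cp T \<and> T \<noteq> {}"
    then obtain f where f: "f \<in> T" by auto
    obtain E V where E: "finite E" "E \<subseteq> topspace X"
        "f \<in> Cp_box X two_point_space E V" "Cp_box X two_point_space E V \<subseteq> T"
      using openin_Cp_contains_box[of X two_point_space T f] T f by metis
    have "finite {n. D n \<inter> E \<noteq> {}}"
    proof -
      have "{n. D n \<inter> E \<noteq> {}} = (\<Union>x\<in>E. {n. x \<in> D n})" by auto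
      moreover have "finite {n. x \<in> D n}" for x
      proof (cases "\<exists>n. x \<in> D n")
        case True
        then obtain n where "x \<in> D n" by auto
        then have "{n. x \<in> D n} \<subseteq> {n}"
          using D(3) unfolding disjoint_family_on_def by blast
        then show ?thesis using finite_subset by blast
      qed auto
      ultimately show ?thesis using E(1) by simp
    qed
    then obtain k where k: "{n. D n \<inter> E \<noteq> {}} \<subseteq> {..<k}"
      using finite_nat_iff_bounded by blast
    define n where "n = max m k"
    have n: "n \<ge> m" "D n \<inter> E = {}"
      using k by (auto simp: n_def)
    obtain g where g: "g \<in> topspace ?Cp" "\<forall>x\<in>D n \<union> E. g x = (if x \<in> D n then s x else f x)"
      using ext[of "D n \<union> E" "\<lambda>x. if x \<in> D n then s x else f x"] D E by auto
    have "g \<in> W (D n)" using g by (auto simp: W_def Cp_box_def)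
    then have "g \<in> U m" using n by (auto simp: U_def)
    moreover have "g x \<in> V x" if "x \<in> E" for x
      using g(2) n that E(3) by (auto simp: Cp_box_def)
    then have "g \<in> T" using E(4) g(1) by (auto simp: Cp_box_def)
    ultimately show "U m \<inter> T \<noteq> {}" by blast
  qed
  have "?Cp closure_of (\<Inter>n. U n) = topspace ?Cp"
    by (rule B[unfolded Baire_space_def, rule_format]) (simp add: U dense)
  moreover have "W C \<noteq> {}"
    using ext[OF C, of s] by (auto simp: W_def Cp_box_def)
  ultimately have "(\<Inter>n. U n) \<inter> W C \<noteq> {}"
    using W[OF C] unfolding dense_intersects_open by simp
  then obtain f where f: "f \<in> W C" "\<And>n. f \<in> U n"
    by blast
  show "\<exists>f\<in>{f. continuous_map X two_point_space f}. f \<in> cylinder C s \<and> infinite {n. f \<in> cylinder (D n) s}"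
  proof (intro bexI[of _ f] conjI)
    show "f \<in> cylinder C s" using f(1) by (simp add: W_def Cp_box_def cylinder_iff)
    show "infinite {n. f \<in> cylinder (D n) s}"
      unfolding infinite_nat_iff_unbounded_le
    proof
      fix m
      show "\<exists>n\<ge>m. n \<in> {n. f \<in> cylinder (D n) s}"
        using f(2)[of m] by (auto simp: U_def W_def Cp_box_def cylinder_iff)
    qed
    show "f \<in> {f. continuous_map X two_point_space f}"
      using f(1) by (simp add: W_def Cp_box_def topspace_Cp)
  qed
qed


section \<open>Maps of the Cantor set into \<open>\<pi>\<close>-monolithic compacta\<close>

definition base_sequence :: "'a topology \<Rightarrow> (nat \<Rightarrow> 'a set) \<Rightarrow> bool"
  where "base_sequence X B \<longleftrightarrow> (\<forall>n. openin X (B n)) \<and>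
    (\<forall>U x. openin X U \<and> x \<in> U \<longrightarrow> (\<exists>n. x \<in> B n \<and> B n \<subseteq> U))"

lemma base_sequence_openin: "base_sequence X B \<Longrightarrow> openin X (B n)"
  by (simp add: base_sequence_def)

lemma base_sequenceD:
  "\<lbrakk>base_sequence X B; openin X U; x \<in> U\<rbrakk> \<Longrightarrow> \<exists>n. x \<in> B n \<and> B n \<subseteq> U"
  by (simp add: base_sequence_def)

lemma compact_metrizable_base_sequence:
  assumes "compact_space X" "metrizable_space X"
  shows "\<exists>B. base_sequence X B"
proof -
  obtain M d where Md: "Metric_space M d" and X: "X = Metric_space.mtopology M d"
    using assms(2) unfolding metrizable_space_def by blast
  interpret Metric_space M d by fact
  have "mtotally_bounded M"
    using assms(1) X compactin_imp_mtotally_bounded by (metis compact_space_def topspace_mtopology)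
  then have "\<exists>K. finite K \<and> K \<subseteq> M \<and> M \<subseteq> (\<Union>x\<in>K. mball x (1 / Suc n))" for n :: nat
    unfolding mtotally_bounded_def by (metis of_nat_0_less_iff zero_less_Suc zero_less_divide_1_iff)
  then obtain K where K: "\<And>n. finite (K n)" "\<And>n. K n \<subseteq> M"
      "\<And>n::nat. M \<subseteq> (\<Union>x\<in>K n. mball x (1 / Suc n))"
    by metis
  \<comment> \<open>The extra \<open>{}\<close> keeps the family nonempty even over an empty space,
    so that it can be enumerated by all naturals.\<close>
  let ?B = "insert {} (\<Union>n. (\<lambda>x. mball x (1 / Suc n)) ` K n)"
  have cB: "countable ?B"
    using K(1) by (intro countable_insert countable_UN) (auto intro: countable_finite)
  define B where "B = from_nat_into ?B"
  have rB: "range B = ?B"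
    unfolding B_def using cB by (intro range_from_nat_into) auto
  show ?thesis
    unfolding base_sequence_def
  proof (intro exI[of _ B] conjI allI impI)
    fix n
    have "openin X V" if "V \<in> range B" for V
      using that unfolding rB X by auto
    then show "openin X (B n)" by blast
  next
    fix U x assume U: "openin X U \<and> x \<in> U"
    then obtain r where r: "r > 0" "mball x r \<subseteq> U" and x: "x \<in> M"
      unfolding X openin_mtopology by blast
    obtain n where n: "1 / Suc n < r / 2"
      using r by (metis half_gt_zero nat_approx_posE)
    obtain y where y: "y \<in> K n" "x \<in> mball y (1 / Suc n)"
      using K(3)[of n] x by blast
    have "mball y (1 / Suc n) \<subseteq> mball x r"
    proof
      fix z assume z: "z \<in> mball y (1 / Suc n)"
      have "d x z \<le> d x y + d y z"
        using y z by (intro triangle) auto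
      then show "z \<in> mball x r"
        using y z n commute[of x y] by auto
    qed
    moreover have "mball y (1 / Suc n) \<in> range B"
      unfolding rB using y(1) by blast
    ultimately show "\<exists>n. x \<in> B n \<and> B n \<subseteq> U"
      using y(2) r(2) by (metis (no_types, lifting) order_trans rangeE)
  qed
qed

text \<open>An irreducible restriction of \<open>f\<close>, obtained by going once through a
  countable base and deleting \<open>B n\<close> whenever the rest still maps onto \<open>M\<close>.
  Surjectivity passes to the limit by compactness of the fibres. An open set meeting the limit
  contains some \<open>B n\<close> that was not deleted, so dropping it already destroyed
  surjectivity at stage \<open>n\<close>.\<close>

lemma minimal_closed_surjection:
  fixes B :: "nat \<Rightarrow> 'a set"
  assumes T: "compact_space T" and M: "Hausdorff_space M"
    and f: "continuous_map T M f" "f ` topspace T = topspace M"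
    and base: "base_sequence T B"
  shows "\<exists>T'. closedin T T' \<and> f ` T' = topspace M \<and>
    (\<forall>U. openin T U \<and> U \<inter> T' \<noteq> {} \<longrightarrow> f ` (T' - U) \<noteq> topspace M)"
proof -
  note B = base_sequence_openin[OF base] base_sequenceD[OF base]
  define E where "E = rec_nat (topspace T)
      (\<lambda>n E. if f ` (E - B n) = topspace M then E - B n else E)"
  have E0: "E 0 = topspace T"
    and ES: "E (Suc n) = (if f ` (E n - B n) = topspace M then E n - B n else E n)" for n
    by (simp_all add: E_def)
  have E: "closedin T (E n) \<and> f ` E n = topspace M" for n
  proof (induction n)
    case 0
    then show ?case using f(2) by (simp add: E0)
  next
    case (Suc n)
    then show ?case using B(1)[of n] by (auto simp: ES intro: closedin_diff)
  qed
  have dec: "decseq E"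
    by (rule decseq_SucI) (auto simp: ES)
  show ?thesis
  proof (intro exI[of _ "\<Inter>n. E n"] conjI allI impI)
    show cl: "closedin T (\<Inter>n. E n)"
      using E by auto
    have "m \<in> f ` (\<Inter>n. E n)" if m: "m \<in> topspace M" for m
    proof -
      let ?C = "\<lambda>n. E n \<inter> {x \<in> topspace T. f x \<in> {m}}"
      have "(\<Inter>n. ?C n) \<noteq> {}"
      proof (rule compact_space_imp_nest[OF T])
        fix n
        show "closedin T (?C n)"
          using E m f M closedin_continuous_map_preimage[OF f(1), of "{m}"]
          by (intro closedin_Int) (auto simp: closedin_Hausdorff_singleton)
        show "?C n \<noteq> {}"
        proof -
          obtain x where "x \<in> E n" "f x = m" using E[of n] m by (metis imageE)
          moreover have "E n \<subseteq> topspace T" using E closedin_subset by blast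
          ultimately show ?thesis by auto
        qed
      next
        show "decseq ?C"
          using dec by (auto simp: decseq_def)
      qed
      then show ?thesis by auto
    qed
    moreover have "f ` (\<Inter>n. E n) \<subseteq> topspace M"
      using E[of 0] by blast
    ultimately show "f ` (\<Inter>n. E n) = topspace M" by blast
  next
    fix U assume "openin T U \<and> U \<inter> (\<Inter>n. E n) \<noteq> {}"
    then have U: "openin T U" "U \<inter> (\<Inter>n. E n) \<noteq> {}" by auto
    then obtain x where x: "x \<in> U" "\<And>n. x \<in> E n" by auto
    obtain n where n: "x \<in> B n" "B n \<subseteq> U" using B(2)[OF U(1) x(1)] by blast
    have "E (Suc n) \<noteq> E n - B n"
      using n x by blast
    then have ne: "f ` (E n - B n) \<noteq> topspace M"
      by (auto simp: ES split: if_splits)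
    have "f ` ((\<Inter>n. E n) - U) \<subseteq> f ` (E n - B n)"
      using n by blast
    moreover have "f ` (E n - B n) \<subseteq> topspace M" using E[of n] by blast
    ultimately show "f ` ((\<Inter>n. E n) - U) \<noteq> topspace M"
      using ne by blast
  qed
qed

lemma decseq_compact_subset_open:
  assumes "compact_space K" "\<And>n. closedin K (C n)" "decseq C" "openin K V" "(\<Inter>n::nat. C n) \<subseteq> V"
  shows "\<exists>n. C n \<subseteq> V"
proof -
  have "\<exists>D\<in>range C. D \<subseteq> V"
  proof (rule compact_space_directed_Inter[OF assms(1)])
    fix A B assume "A \<in> range C" "B \<in> range C"
    then obtain m n where "A = C m" "B = C n" by auto
    then have "C (max m n) \<subseteq> A \<inter> B" using assms(3) by (auto simp: decseq_def)
    then show "\<exists>D\<in>range C. D \<subseteq> A \<inter> B" by blast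
  qed (use assms in auto)
  then show ?thesis by auto
qed

text \<open>Reading the digits of \<open>c\<close>, one shrinks an open set so that its closure avoids
  \<open>B n\<close> or is contained in the closure of \<open>B n\<close>, at each step \<open>n\<close>.\<close>

lemma cantor_surjection_with_large_cylinders:
  fixes B :: "nat \<Rightarrow> 'a set"
  assumes S: "compact_space S" "Hausdorff_space S" "topspace S \<noteq> {}"
    and base: "base_sequence S B"
  shows "\<exists>h :: (nat \<Rightarrow> bool) \<Rightarrow> 'a. continuous_map cantor_cube S h \<and> range h = topspace S \<and>
    (\<forall>c n. \<exists>W. openin S W \<and> W \<noteq> {} \<and> W \<subseteq> h ` cylinder {..<n} c)"
proof -
  note B = base_sequence_openin[OF base] base_sequenceD[OF base]
  define V where "V c n w = (if c n then w \<inter> B n else w - S closure_of B n)"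
    for c :: "nat \<Rightarrow> bool" and n w
  \<comment> \<open>A digit that would leave nothing is ignored, so the sets stay nonempty. The
    dichotomy \<open>split\<close> survives this: when one alternative for \<open>B n\<close> is
    empty, the current set already satisfies the other.\<close>
  define W where "W c = rec_nat (topspace S) (\<lambda>n w. if V c n w = {} then w else V c n w)" for c
  have W0: "W c 0 = topspace S"
    and WS: "W c (Suc n) = (if V c n (W c n) = {} then W c n else V c n (W c n))" for c n
    by (simp_all add: W_def)
  have Vo: "openin S (V c n w)" if "openin S w" for c n w
    using that B(1)[of n] by (auto simp: V_def intro: openin_diff)
  have W: "openin S (W c n) \<and> W c n \<noteq> {}" for c n
    by (induction n) (use S(3) Vo in \<open>auto simp: W0 WS\<close>)
  have Wsub: "W c n \<subseteq> topspace S" for c n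
    using W openin_subset by blast
  have Vsub: "V c n w \<subseteq> w" for c n w
    by (auto simp: V_def)
  have Wdec: "W c (Suc n) \<subseteq> W c n" for c n
    using Vsub by (simp add: WS)
  have Wcyl: "W d n = W c n" if "d \<in> cylinder {..<n} c" for c d n
    using that
  proof (induction n)
    case (Suc n)
    then have "d \<in> cylinder {..<n} c" "d n = c n" by (auto simp: cylinder_iff)
    then show ?case using Suc.IH by (simp add: WS V_def)
  qed (simp add: W0)
  define C where "C c n = S closure_of W c n" for c n
  have Ccl: "closedin S (C c n)" for c n
    by (simp add: C_def)
  have Cdec: "decseq (C c)" for c
    by (rule decseq_SucI) (simp add: C_def closure_of_mono Wdec)
  have Cne: "C c n \<noteq> {}" for c n
    using W[of c n] Wsub[of c n] by (simp add: C_def closure_of_eq_empty)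
  have split: "W c (Suc n) \<inter> B n = {} \<or> W c (Suc n) \<subseteq> S closure_of B n" for c n
  proof -
    have "B n \<subseteq> S closure_of B n"
      using B(1) by (simp add: closure_of_subset openin_subset)
    then show ?thesis
      using Wsub[of c n] by (auto simp: WS V_def)
  qed
  have unique: "x = y" if x: "\<And>n. x \<in> C c n" and y: "\<And>n. y \<in> C c n" for c x y
  proof (rule ccontr)
    assume "x \<noteq> y"
    moreover have "x \<in> topspace S" "y \<in> topspace S"
      using x[of 0] y[of 0] by (auto simp: C_def in_closure_of)
    ultimately obtain O1 O2 where O: "openin S O1" "openin S O2" "x \<in> O1" "y \<in> O2" "disjnt O1 O2"
      using S(2) unfolding Hausdorff_space_def by blast
    obtain n where n: "x \<in> B n" "B n \<subseteq> O1" using B(2)[OF O(1,3)] by blast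
    have "O2 \<inter> B n = {}"
      using O(5) n(2) by (auto simp: disjnt_iff)
    then have "O2 \<inter> S closure_of B n = {}"
      using O(2) openin_Int_closure_of_eq_empty by blast
    then have yn: "y \<notin> S closure_of B n" using O(4) by blast
    from split[of c n] show False
    proof
      assume "W c (Suc n) \<inter> B n = {}"
      then have "B n \<inter> C c (Suc n) = {}"
        unfolding C_def using B(1) openin_Int_closure_of_eq_empty by (metis inf_commute)
      then show False using x n by blast
    next
      assume "W c (Suc n) \<subseteq> S closure_of B n"
      then have "C c (Suc n) \<subseteq> S closure_of B n"
        unfolding C_def by (simp add: closure_of_minimal)
      then show False using y yn by blast
    qed
  qed
  have "\<exists>x. \<forall>n. x \<in> C c n" for c
    using compact_space_imp_nest[OF S(1) Ccl Cne Cdec, of c] by blast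
  then obtain h where h: "\<And>c n. h c \<in> C c n" by metis
  have hC: "(\<Inter>n. C c n) = {h c}" for c
  proof (intro equalityI subsetI)
    fix x assume "x \<in> (\<Inter>n. C c n)"
    then have x: "x \<in> C c n" for n by blast
    show "x \<in> {h c}" using unique[OF x h] by simp
  qed (use h in simp)
  \<comment> \<open>The parts of \<open>W c n\<close> inside \<open>B n\<close> and off the closure
    of \<open>B n\<close> have dense union in \<open>W c n\<close>. Hence a point in the closure of
    \<open>W c n\<close> is in the closure of one of them, which is then nonempty and really chosen
    by the recursion.\<close>
  have step: "\<exists>c'\<in>cylinder {..<n} c. w \<in> C c' (Suc n)" if w: "w \<in> C c n" for c n w
  proof (cases "w \<in> S closure_of (W c n \<inter> B n)")
    case True
    let ?c = "c(n := True)"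
    have cyl: "?c \<in> cylinder {..<n} c" by (simp add: cylinder_iff)
    have "W c n \<inter> B n \<noteq> {}" using True by auto
    then have "W ?c (Suc n) = W c n \<inter> B n"
      using Wcyl[OF cyl] by (simp add: WS V_def)
    then show ?thesis using True cyl unfolding C_def by metis
  next
    case False
    let ?c = "c(n := False)"
    have cyl: "?c \<in> cylinder {..<n} c" by (simp add: cylinder_iff)
    have wS: "w \<in> topspace S" using w by (auto simp: C_def in_closure_of)
    then obtain G where G: "w \<in> G" "openin S G" "G \<inter> (W c n \<inter> B n) = {}"
      using False unfolding in_closure_of by blast
    have cl: "w \<in> S closure_of (W c n - S closure_of B n)"
      unfolding in_closure_of
    proof (intro conjI allI impI wS)
      fix T assume T: "w \<in> T \<and> openin S T"
      then have "openin S (T \<inter> G)" "w \<in> T \<inter> G" using G by auto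
      then obtain y where y: "y \<in> W c n" "y \<in> T \<inter> G"
        using w unfolding C_def in_closure_of by blast
      have "openin S (T \<inter> G \<inter> W c n)" using T G W by blast
      moreover have "(T \<inter> G \<inter> W c n) \<inter> B n = {}" using G(3) by blast
      ultimately have "(T \<inter> G \<inter> W c n) \<inter> S closure_of B n = {}"
        using openin_Int_closure_of_eq_empty by blast
      then show "\<exists>y. y \<in> W c n - S closure_of B n \<and> y \<in> T"
        using y by blast
    qed
    then have "W c n - S closure_of B n \<noteq> {}" by (metis closure_of_empty empty_iff)
    then have "W ?c (Suc n) = W c n - S closure_of B n"
      using Wcyl[OF cyl] by (simp add: WS V_def)
    then show ?thesis using cl cyl unfolding C_def by metis
  qed
  have onto: "w \<in> h ` cylinder {..<n} c" if w: "w \<in> C c n" for c n w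
  proof -
    have "\<exists>e. \<forall>k. (w \<in> C (e k) (n + k) \<and> (k = 0 \<longrightarrow> e k = c)) \<and> e (Suc k) \<in> cylinder {..<n + k} (e k)"
    proof (rule dependent_nat_choice)
      show "\<exists>x. w \<in> C x (n + 0) \<and> (0 = (0::nat) \<longrightarrow> x = c)" using w by auto
    next
      fix x and k assume "w \<in> C x (n + k) \<and> (k = 0 \<longrightarrow> x = c)"
      then show "\<exists>y. (w \<in> C y (n + Suc k) \<and> (Suc k = 0 \<longrightarrow> y = c)) \<and> y \<in> cylinder {..<n + k} x"
        using step[of w x "n + k"] by auto
    qed
    then obtain e where e: "\<And>k. w \<in> C (e k) (n + k)" "e 0 = c"
        "\<And>k. e (Suc k) \<in> cylinder {..<n + k} (e k)"
      by blast
    have agree: "e k' i = e k i" if "k \<le> k'" "i < n + k" for i k k'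
      using that
    proof (induction k' rule: dec_induct)
      case (step m)
      then show ?case using e(3)[of m] by (auto simp: cylinder_iff)
    qed simp
    \<comment> \<open>From stage \<open>k\<close> on, the digits below \<open>n + k\<close> are
      final; so digit \<open>i\<close> can be read off at stage \<open>Suc i\<close>, even for
      \<open>n = 0\<close>.\<close>
    define d where "d i = e (Suc i) i" for i
    have dk: "d \<in> cylinder {..<n + k} (e k)" for k
      unfolding cylinder_iff
    proof
      fix i assume "i \<in> {..<n + k}"
      then show "d i = e k i"
        using agree[of k "Suc i" i] agree[of "Suc i" k i] by (cases "k \<le> Suc i") (auto simp: d_def)
    qed
    have dC: "w \<in> C d (n + k)" for k
      using e(1)[of k] Wcyl[OF dk[of k]] by (simp add: C_def)
    have "w \<in> C d k" for k
    proof -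
      have "C d (n + k) \<subseteq> C d k" using Cdec[of d] by (auto simp: decseq_def)
      then show ?thesis using dC[of k] by blast
    qed
    then have "w = h d" using unique[of w d "h d"] h by blast
    moreover have "d \<in> cylinder {..<n} c" using dk[of 0] e(2) by simp
    ultimately show ?thesis by blast
  qed
  show ?thesis
  proof (intro exI[of _ h] conjI allI)
    have hS: "range h \<subseteq> topspace S"
      using h[of _ 0] by (auto simp: C_def in_closure_of)
    show "continuous_map cantor_cube S h"
      unfolding continuous_map_cantor_cube_iff
    proof (intro conjI allI impI hS)
      fix U c assume U: "openin S U \<and> h c \<in> U"
      have "\<exists>n. C c n \<subseteq> U"
        using U by (intro decseq_compact_subset_open[OF S(1) Ccl Cdec]) (auto simp: hC)
      then obtain n where n: "C c n \<subseteq> U" by blast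
      have "h d \<in> U" if "d \<in> cylinder {..<n} c" for d
        using h[of d n] n Wcyl[OF that] by (auto simp: C_def)
      then show "\<exists>J. finite J \<and> h ` cylinder J c \<subseteq> U"
        by (intro exI[of _ "{..<n}"]) auto
    qed
    have "C c 0 = topspace S" for c
      by (simp add: C_def W0)
    then have "topspace S \<subseteq> range h" using onto[of _ _ 0] by blast
    with hS show "range h = topspace S" by blast
    fix c n
    have "W c n \<subseteq> C c n" unfolding C_def by (simp add: closure_of_subset Wsub)
    then have "W c n \<subseteq> h ` cylinder {..<n} c" using onto by blast
    then show "\<exists>W. openin S W \<and> W \<noteq> {} \<and> W \<subseteq> h ` cylinder {..<n} c"
      using W[of c n] by (intro exI[of _ "W c n"]) simp
  qed
qed

text \<open>The metrizable set given by \<pi>-monolithicity is shrunk to a set \<open>T'\<close> on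
  which \<open>f\<close> is irreducible, and \<open>h\<close> maps the Cantor set onto
  \<open>T'\<close>. Irreducibility carries interiors over to \<open>M\<close>: if \<open>U\<close>
  is open and meets \<open>T'\<close>, then the complement of the image of \<open>T' - U\<close> is
  nonempty, open by compactness, and covered by the image of the part of \<open>T'\<close> in
  \<open>U\<close>.\<close>

lemma pi_monolithic_cantor_map:
  fixes K :: "'k topology" and M :: "'m topology"
  assumes K: "Hausdorff_space K" "pi_monolithic_space K"
    and M: "compact_space M" "metrizable_space M" "topspace M \<noteq> {}"
    and f: "continuous_map K M f" "f ` topspace K = topspace M"
  shows "\<exists>h :: (nat \<Rightarrow> bool) \<Rightarrow> 'k. continuous_map cantor_cube K h \<and> f ` range h = topspace M \<and>
    (\<forall>c n. \<exists>G. openin M G \<and> G \<noteq> {} \<and> G \<subseteq> f ` h ` cylinder {..<n} c)"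
proof -
  have HM: "Hausdorff_space M"
    using M(2) by (simp add: metrizable_imp_Hausdorff_space)
  obtain T where T: "compactin K T" "metrizable_space (subtopology K T)" "f ` T = topspace M"
    using pi_monolithic_spaceD[OF K(2) M(1,2) f] by blast
  let ?T = "subtopology K T"
  have TK: "T \<subseteq> topspace K" using T(1) compactin_subset_topspace by blast
  then have tT: "topspace ?T = T" by auto
  have cT: "compact_space ?T" using T(1) by (simp add: compact_space_subtopology)
  obtain B where B: "base_sequence ?T B"
    using compact_metrizable_base_sequence[OF cT T(2)] by blast
  have fT: "continuous_map ?T M f" using f(1) continuous_map_from_subtopology by blast
  obtain T' where T': "closedin ?T T'" "f ` T' = topspace M"
      "\<forall>U. openin ?T U \<and> U \<inter> T' \<noteq> {} \<longrightarrow> f ` (T' - U) \<noteq> topspace M"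
    using minimal_closed_surjection[OF cT HM fT _ B] T(3) tT by metis
  let ?S = "subtopology ?T T'"
  have T'T: "T' \<subseteq> T" using closedin_subset[OF T'(1)] tT by simp
  then have tS: "topspace ?S = T'" using TK by auto
  have T'ne: "T' \<noteq> {}" using T'(2) M(3) by blast
  have S: "compact_space ?S" "Hausdorff_space ?S" "metrizable_space ?S" "topspace ?S \<noteq> {}"
    using closedin_compact_space[OF cT T'(1)] K(1) T(2) T'ne tS
    by (simp_all add: compact_space_subtopology Hausdorff_space_subtopology metrizable_space_subtopology)
  obtain B' where B': "base_sequence ?S B'"
    using compact_metrizable_base_sequence[OF S(1,3)] by blast
  obtain h :: "(nat \<Rightarrow> bool) \<Rightarrow> 'k"
    where h: "continuous_map cantor_cube ?S h" "range h = topspace ?S"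
    "\<forall>c n. \<exists>W. openin ?S W \<and> W \<noteq> {} \<and> W \<subseteq> h ` cylinder {..<n} c"
    using cantor_surjection_with_large_cylinders[OF S(1,2,4) B'] by metis
  show ?thesis
  proof (intro exI[of _ h] conjI allI)
    show "continuous_map cantor_cube K h"
      using h(1) by (simp add: continuous_map_in_subtopology)
    show "f ` range h = topspace M" using h(2) T'(2) tS by simp
    fix c n
    obtain W where W: "openin ?S W" "W \<noteq> {}" "W \<subseteq> h ` cylinder {..<n} c" using h(3) by metis
    then obtain U where U: "openin ?T U" "W = U \<inter> T'" by (auto simp: openin_subtopology)
    have "closedin ?T (T' - U)" using T'(1) U(1) by (simp add: closedin_diff)
    then have "compactin ?T (T' - U)" using cT closedin_compact_space by blast
    then have "compactin M (f ` (T' - U))" using fT image_compactin by blast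
    then have "closedin M (f ` (T' - U))" using HM compactin_imp_closedin by blast
    then have G: "openin M (topspace M - f ` (T' - U))" by blast
    have "f ` (T' - U) \<noteq> topspace M" using T'(3) U W(2) by simp
    moreover have "f ` (T' - U) \<subseteq> topspace M" using T'(2) by blast
    ultimately have "topspace M - f ` (T' - U) \<noteq> {}" by blast
    moreover have "topspace M - f ` (T' - U) \<subseteq> f ` W"
      using T'(2) U(2) by blast
    ultimately show "\<exists>G. openin M G \<and> G \<noteq> {} \<and> G \<subseteq> f ` h ` cylinder {..<n} c"
      using G W(3) by (meson image_mono order_trans)
  qed
qed


section \<open>Baireness for \<open>\<pi>\<close>-monolithic compacta\<close>

text \<open>A finite \<open>p\<close> encodes a basic open set of functions by strict inequalities.
  Real functions are used in place of open sets of values because countably many of them define a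
  metrizable quotient.\<close>

definition positive_on :: "('x \<times> ('k \<Rightarrow> real)) set \<Rightarrow> ('x \<Rightarrow> 'k) \<Rightarrow> bool"
  where "positive_on p g \<longleftrightarrow> (\<forall>(x, \<phi>)\<in>p. 0 < \<phi> (g x))"

lemma positive_on_empty [simp]: "positive_on {} g"
  by (simp add: positive_on_def)

lemma positive_on_insert [simp]:
  "positive_on (insert (x, \<phi>) p) g \<longleftrightarrow> 0 < \<phi> (g x) \<and> positive_on p g"
  by (simp add: positive_on_def)

lemma positive_on_Un [simp]: "positive_on (p \<union> q) g \<longleftrightarrow> positive_on p g \<and> positive_on q g"
  by (auto simp: positive_on_def)

lemma positive_onD: "\<lbrakk>positive_on p g; (x, \<phi>) \<in> p\<rbrakk> \<Longrightarrow> 0 < \<phi> (g x)"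
  by (auto simp: positive_on_def)

lemma positive_onI: "(\<And>x \<phi>. (x, \<phi>) \<in> p \<Longrightarrow> 0 < \<phi> (g x)) \<Longrightarrow> positive_on p g"
  by (auto simp: positive_on_def)

lemma openin_positive:
  assumes "continuous_map K euclideanreal \<phi>"
  shows "openin K {k \<in> topspace K. 0 < \<phi> k}"
  using openin_continuous_map_preimage[OF assms, of "{0<..}"] by simp

definition conditions :: "'x topology \<Rightarrow> 'k topology \<Rightarrow> ('x \<times> ('k \<Rightarrow> real)) set"
  where "conditions X K = topspace X \<times> {\<phi>. continuous_map K euclideanreal \<phi>}"

definition Cp_positive :: "'x topology \<Rightarrow> 'k topology \<Rightarrow> ('x \<times> ('k \<Rightarrow> real)) set \<Rightarrow> ('x \<Rightarrow> 'k) set"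
  where "Cp_positive X K p = {f \<in> topspace (Cp X K). positive_on p f}"

lemma Cp_positive_iff: "f \<in> Cp_positive X K p \<longleftrightarrow> f \<in> topspace (Cp X K) \<and> positive_on p f"
  by (simp add: Cp_positive_def)

lemma openin_Cp_positive:
  assumes "finite p" "p \<subseteq> conditions X K"
  shows "openin (Cp X K) (Cp_positive X K p)"
  using assms
proof (induction p)
  case empty
  then show ?case by (simp add: Cp_positive_def)
next
  case (insert c p)
  obtain x \<phi> where c: "c = (x, \<phi>)" by force
  have x: "x \<in> topspace X" and \<phi>: "continuous_map K euclideanreal \<phi>"
    using insert.prems by (auto simp: c conditions_def)
  have "Cp_positive X K (insert c p) =
      Cp_box X K {x} (\<lambda>_. {k \<in> topspace K. 0 < \<phi> k}) \<inter> Cp_positive X K p"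
    using x by (auto simp: Cp_positive_def Cp_box_def c topspace_Cp continuous_map_def)
  moreover have "openin (Cp X K) (Cp_box X K {x} (\<lambda>_. {k \<in> topspace K. 0 < \<phi> k}))"
    using x openin_positive[OF \<phi>] by (intro openin_Cp_box) auto
  ultimately show ?case using insert by auto
qed

lemma openin_Cp_contains_positive:
  assumes K: "completely_regular_space K" and U: "openin (Cp X K) U" "f \<in> U"
  shows "\<exists>p. finite p \<and> p \<subseteq> conditions X K \<and> positive_on p f \<and> Cp_positive X K p \<subseteq> U"
proof -
  obtain D V where D: "finite D" "D \<subseteq> topspace X" "\<forall>x\<in>D. openin K (V x)"
      "f \<in> Cp_box X K D V" "Cp_box X K D V \<subseteq> U"
    using openin_Cp_contains_box[OF U] by metis
  have "\<exists>\<phi>. continuous_map K euclideanreal \<phi> \<and> 0 < \<phi> (f x) \<and> (\<forall>k\<in>topspace K. 0 < \<phi> k \<longrightarrow> k \<in> V x)"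
    if x: "x \<in> D" for x
  proof -
    have "openin K (V x)" "f x \<in> V x" using D x by (auto simp: Cp_box_def)
    then obtain \<psi> where \<psi>: "continuous_map K euclideanreal \<psi>" "\<psi> (f x) = 0"
        "\<psi> ` (topspace K - V x) \<subseteq> {1}"
      using K unfolding completely_regular_space_alt' by blast
    show ?thesis
    proof (intro exI[of _ "\<lambda>k. 1/2 - \<psi> k"] conjI ballI impI)
      show "continuous_map K euclideanreal (\<lambda>k. 1/2 - \<psi> k)"
        using \<psi>(1) by (intro continuous_intros) auto
      fix k assume "k \<in> topspace K" "0 < 1/2 - \<psi> k"
      then show "k \<in> V x" using \<psi>(3) by force
    qed (use \<psi> in auto)
  qed
  then obtain \<phi> where \<phi>: "\<And>x. x \<in> D \<Longrightarrow> continuous_map K euclideanreal (\<phi> x)"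
      "\<And>x. x \<in> D \<Longrightarrow> 0 < \<phi> x (f x)"
      "\<And>x k. \<lbrakk>x \<in> D; k \<in> topspace K; 0 < \<phi> x k\<rbrakk> \<Longrightarrow> k \<in> V x"
    by metis
  let ?p = "(\<lambda>x. (x, \<phi> x)) ` D"
  have "Cp_positive X K ?p \<subseteq> Cp_box X K D V"
  proof
    fix g assume g: "g \<in> Cp_positive X K ?p"
    have "g x \<in> V x" if x: "x \<in> D" for x
    proof (rule \<phi>(3)[OF x])
      show "g x \<in> topspace K"
        using g x D(2) by (auto simp: Cp_positive_def topspace_Cp continuous_map_def)
      show "0 < \<phi> x (g x)"
        using g x by (auto simp: Cp_positive_def positive_on_def)
    qed
    then show "g \<in> Cp_box X K D V" using g by (simp add: Cp_box_def Cp_positive_def)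
  qed
  then show ?thesis
    using D \<phi> by (intro exI[of _ ?p]) (auto simp: conditions_def positive_on_def)
qed

text \<open>The witness \<open>g\<close> may be discontinuous: only its values at the finitely many
  points mentioned in \<open>p\<close> count, and a continuous map takes them too. Density then
  yields a member of \<open>U\<close> satisfying \<open>p\<close>, and a basic neighbourhood of it
  is joined to \<open>p\<close>.\<close>

lemma dense_Cp_refine_condition:
  assumes X: "quasi_totally_disconnected_space X" and K: "completely_regular_space K"
    and U: "openin (Cp X K) U" "Cp X K closure_of U = topspace (Cp X K)"
    and p: "finite p" "p \<subseteq> conditions X K" "positive_on p g"
      "\<And>x. x \<in> fst ` p \<Longrightarrow> g x \<in> topspace K" "topspace K \<noteq> {}"
  shows "\<exists>p'. finite p' \<and> p \<subseteq> p' \<and> p' \<subseteq> conditions X K \<and> Cp_positive X K p' \<noteq> {} \<and>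
    Cp_positive X K p' \<subseteq> U"
proof -
  obtain k where k: "k \<in> topspace K" using p(5) by blast
  have D: "finite (fst ` p)" "fst ` p \<subseteq> topspace X"
    using p(1,2) by (auto simp: conditions_def)
  obtain f0 where f0: "f0 \<in> topspace (Cp X K)" "\<forall>x\<in>fst ` p. f0 x = g x"
    using Cp_extension_finite[OF X D, of g K k] p(4) k by blast
  have "positive_on p f0"
  proof (rule positive_onI)
    fix x \<phi> assume c: "(x, \<phi>) \<in> p"
    then have "f0 x = g x" using f0(2) by force
    then show "0 < \<phi> (f0 x)" using positive_onD[OF p(3) c] by simp
  qed
  then have "Cp_positive X K p \<noteq> {}" using f0(1) by (auto simp: Cp_positive_def)
  then obtain f1 where f1: "f1 \<in> U" "f1 \<in> Cp_positive X K p"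
    using U(2) openin_Cp_positive[OF p(1,2)] unfolding dense_intersects_open by blast
  obtain q where q: "finite q" "q \<subseteq> conditions X K" "positive_on q f1" "Cp_positive X K q \<subseteq> U"
    using openin_Cp_contains_positive[OF K U(1) f1(1)] by blast
  have "f1 \<in> Cp_positive X K (p \<union> q)" using f1(2) q(3) by (simp add: Cp_positive_iff)
  moreover have "Cp_positive X K (p \<union> q) \<subseteq> Cp_positive X K q" by (auto simp: Cp_positive_iff)
  ultimately show ?thesis
    using p(1,2) q by (intro exI[of _ "p \<union> q"]) auto
qed

lemma positive_on_cantor_open:
  fixes h :: "(nat \<Rightarrow> bool) \<Rightarrow> 'k"
  assumes h: "continuous_map cantor_cube K h"
    and "finite p" "p \<subseteq> conditions X K" "positive_on p (\<lambda>x. h (\<lambda>i. u (x, i)))"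
  shows "\<exists>E. finite E \<and> E \<subseteq> topspace X \<times> UNIV \<and>
    (\<forall>v\<in>cylinder E u. positive_on p (\<lambda>x. h (\<lambda>i. v (x, i))))"
  using assms(2-4)
proof (induction p)
  case empty
  then show ?case by (intro exI[of _ "{}"]) auto
next
  case (insert c p)
  obtain x \<phi> where c: "c = (x, \<phi>)" by force
  have x: "x \<in> topspace X" and \<phi>: "continuous_map K euclideanreal \<phi>"
    using insert.prems by (auto simp: c conditions_def)
  obtain E where E: "finite E" "E \<subseteq> topspace X \<times> UNIV"
      "\<forall>v\<in>cylinder E u. positive_on p (\<lambda>x. h (\<lambda>i. v (x, i)))"
    using insert by (auto simp: c)
  have "h (\<lambda>i. u (x, i)) \<in> {k \<in> topspace K. 0 < \<phi> k}"
    using insert.prems h by (auto simp: c continuous_map_cantor_cube_iff)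
  then obtain n where n: "h ` cylinder {..<n} (\<lambda>i. u (x, i)) \<subseteq> {k \<in> topspace K. 0 < \<phi> k}"
    using continuous_map_cantorE[OF h openin_positive[OF \<phi>], of "\<lambda>i. u (x, i)"] by metis
  show ?case
  proof (intro exI[of _ "E \<union> {x} \<times> {..<n}"] conjI ballI)
    fix v assume v: "v \<in> cylinder (E \<union> {x} \<times> {..<n}) u"
    then have "(\<lambda>i. v (x, i)) \<in> cylinder {..<n} (\<lambda>i. u (x, i))" by (auto simp: cylinder_iff)
    then have "0 < \<phi> (h (\<lambda>i. v (x, i)))" using n by auto
    moreover have "v \<in> cylinder E u" using v by (auto simp: cylinder_iff)
    ultimately show "positive_on (insert c p) (\<lambda>x. h (\<lambda>i. v (x, i)))"
      using E(3) by (simp add: c)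
  qed (use E x in auto)
qed

lemma open_real_contains_rational_interval:
  assumes "open V" "(r :: real) \<in> V"
  shows "\<exists>a b :: rat. of_rat a < r \<and> r < of_rat b \<and> {of_rat a<..<of_rat b} \<subseteq> V"
proof -
  obtain e where e: "e > 0" "ball r e \<subseteq> V" using assms open_contains_ball by blast
  obtain a :: rat where a: "r - e < of_rat a" "of_rat a < r" using of_rat_dense[of "r - e" r] e by auto
  obtain b :: rat where b: "r < of_rat b" "of_rat b < r + e" using of_rat_dense[of r "r + e"] e by auto
  have "{of_rat a<..<of_rat b} \<subseteq> ball r e" using a b by (auto simp: dist_real_def)
  then show ?thesis using a b e by blast
qed

text \<open>The bounds \<open>a < e i k < b\<close> hold iff the minimum of \<open>e i k - a\<close>
  and \<open>b - e i k\<close> is positive. With closure under minima and rational shifts, a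
  neighbourhood in the quotient thus becomes positivity of a single member of \<Phi>, that is, a
  condition.\<close>

lemma countable_functions_base:
  fixes e :: "nat \<Rightarrow> 'k \<Rightarrow> real" and K :: "'k topology"
  defines "F \<equiv> \<lambda>k n. e n k"
  assumes one: "(\<lambda>_. 1) \<in> \<Phi>" and e: "range e = \<Phi>"
    and min: "\<And>\<phi> \<psi>. \<lbrakk>\<phi> \<in> \<Phi>; \<psi> \<in> \<Phi>\<rbrakk> \<Longrightarrow> (\<lambda>k. min (\<phi> k) (\<psi> k)) \<in> \<Phi>"
    and lower: "\<And>\<phi> q. \<phi> \<in> \<Phi> \<Longrightarrow> (\<lambda>k. \<phi> k - of_rat q) \<in> \<Phi>"
    and upper: "\<And>\<phi> q. \<phi> \<in> \<Phi> \<Longrightarrow> (\<lambda>k. of_rat q - \<phi> k) \<in> \<Phi>"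
    and G: "open G" "F k \<in> G"
  shows "\<exists>\<phi>\<in>\<Phi>. 0 < \<phi> k \<and> (\<forall>k'. 0 < \<phi> k' \<longrightarrow> F k' \<in> G)"
proof -
  have "openin (product_topology (\<lambda>_. euclideanreal) UNIV) G"
    using G(1) by (simp add: euclidean_product_topology)
  then obtain V where V: "F k \<in> PiE UNIV V" "\<And>i. open (V i)" "finite {i. V i \<noteq> UNIV}"
      "PiE UNIV V \<subseteq> G"
    using product_topology_open_contains_basis[of "\<lambda>_. euclideanreal" UNIV G "F k"] G(2) by auto
  have "\<exists>\<phi>\<in>\<Phi>. 0 < \<phi> k \<and> (\<forall>k'. 0 < \<phi> k' \<longrightarrow> (\<forall>i\<in>J. e i k' \<in> V i))" if "finite J" for J
    using that
  proof (induction J)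
    case empty
    then show ?case using one by (intro bexI[of _ "\<lambda>_. 1"]) auto
  next
    case (insert i J)
    then obtain \<phi> where \<phi>: "\<phi> \<in> \<Phi>" "0 < \<phi> k" "\<And>k'. 0 < \<phi> k' \<Longrightarrow> (\<forall>i\<in>J. e i k' \<in> V i)" by auto
    have "e i k \<in> V i" using V(1) by (auto simp: F_def)
    then obtain a b :: rat where ab: "of_rat a < e i k" "e i k < of_rat b"
        "{of_rat a<..<of_rat b} \<subseteq> V i"
      using open_real_contains_rational_interval[OF V(2)] by blast
    have ei: "e i \<in> \<Phi>" using e by auto
    let ?\<psi> = "\<lambda>k. min (\<phi> k) (min (e i k - of_rat a) (of_rat b - e i k))"
    have "?\<psi> \<in> \<Phi>" by (rule min[OF \<phi>(1) min[OF lower[OF ei] upper[OF ei]]])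
    moreover have "0 < ?\<psi> k" using \<phi>(2) ab by simp
    moreover have "\<forall>j\<in>insert i J. e j k' \<in> V j" if "0 < ?\<psi> k'" for k'
      using that \<phi>(3)[of k'] ab(3) by (auto simp: subset_iff)
    ultimately show ?case by (intro bexI[of _ ?\<psi>] conjI allI impI)
  qed
  from this[OF V(3)] obtain \<phi> where \<phi>: "\<phi> \<in> \<Phi>" "0 < \<phi> k"
      "\<And>k'. 0 < \<phi> k' \<Longrightarrow> \<forall>i\<in>{i. V i \<noteq> UNIV}. e i k' \<in> V i" by auto
  have "F k' \<in> G" if "0 < \<phi> k'" for k'
  proof -
    have "F k' i \<in> V i" for i
      using \<phi>(3)[OF that] by (cases "V i = UNIV") (auto simp: F_def)
    then have "F k' \<in> PiE UNIV V" by auto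
    then show ?thesis using V(4) by blast
  qed
  then show ?thesis using \<phi> by blast
qed


text \<open>All conditions met in the proof are confined to a countable set \<open>A \<times> \<Phi>\<close> that is closed
  under refinement; the functions in \<open>\<Phi>\<close> define the metrizable quotient.\<close>

theorem interpolating_imp_Baire_Cp:
  fixes X :: "'x topology" and K :: "'k topology"
  assumes X: "quasi_totally_disconnected_space X"
    and I: "interpolating (topspace X) {f. continuous_map X two_point_space f}"
    and K: "compact_Hausdorff_space K" "pi_monolithic_space K"
  shows "Baire_space (Cp X K)"
  unfolding Baire_space_def
proof (intro allI impI)
  fix U :: "nat \<Rightarrow> ('x \<Rightarrow> 'k) set"
  assume "\<forall>n. openin (Cp X K) (U n) \<and> Cp X K closure_of U n = topspace (Cp X K)"
  then have U: "\<And>n. openin (Cp X K) (U n)" "\<And>n. Cp X K closure_of U n = topspace (Cp X K)"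
    by auto
  have crK: "completely_regular_space K"
    using compact_Hausdorff_imp_tychonoff[OF K(1)] by (simp add: tychonoff_space_def)
  have cK: "compact_space K" and HK: "Hausdorff_space K"
    using K(1) by (auto simp: compact_Hausdorff_space_def)
  let ?Z = "conditions X K"
  have "(\<Inter>n. U n) \<inter> V \<noteq> {}" if V: "openin (Cp X K) V" "f0 \<in> V" for V f0
  proof (cases "topspace X = {}")
    \<comment> \<open>With no points, \<open>Cp X K\<close> has at most one element, and the
      closing-off of the other case would have no \<open>x0\<close> to start from.\<close>
    case True
    have "f = (\<lambda>_. undefined)" if "f \<in> topspace (Cp X K)" for f
      using that True by (simp add: topspace_Cp extensional_empty)
    moreover have "U n \<subseteq> topspace (Cp X K)" "V \<subseteq> topspace (Cp X K)" for n
      using U(1) V(1) by (auto dest: openin_subset)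
    moreover have "U n \<inter> V \<noteq> {}" for n
      using U(2)[of n] V unfolding dense_intersects_open by blast
    ultimately have "(\<lambda>_. undefined) \<in> U n \<inter> V" for n
      by (metis IntD1 all_not_in_conv subsetD)
    then show ?thesis by blast
  next
    case False
    then obtain x0 where x0: "x0 \<in> topspace X" by blast
    have f0: "f0 \<in> topspace (Cp X K)" using V openin_subset by blast
    have f0K: "f0 x \<in> topspace K" if "x \<in> topspace X" for x
      using f0 that by (auto simp: topspace_Cp continuous_map_def)
    have Kne: "topspace K \<noteq> {}" using f0K[OF x0] by blast
    obtain p0 where p0: "finite p0" "p0 \<subseteq> ?Z" "positive_on p0 f0" "Cp_positive X K p0 \<subseteq> V"
      using openin_Cp_contains_positive[OF crK V] by blast
    define good where "good p \<longleftrightarrow> finite p \<and> p \<subseteq> ?Z \<and>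
        (\<exists>g. positive_on p g \<and> (\<forall>x\<in>fst ` p. g x \<in> topspace K))" for p
    define refines where "refines n p p' \<longleftrightarrow> finite p' \<and> p \<subseteq> p' \<and> p' \<subseteq> ?Z \<and>
        Cp_positive X K p' \<noteq> {} \<and> Cp_positive X K p' \<subseteq> U n" for n p p'
    have "\<exists>p'. good p \<longrightarrow> refines n p p'" for p n
    proof (cases "good p")
      case True
      then obtain g where g: "finite p" "p \<subseteq> ?Z" "positive_on p g" "\<forall>x\<in>fst ` p. g x \<in> topspace K"
        by (auto simp: good_def)
      have "\<exists>p'. refines n p p'"
        unfolding refines_def
        by (rule dense_Cp_refine_condition[OF X crK U(1,2) g(1-3) _ Kne]) (use g(4) in blast)
      then show ?thesis by blast
    qed auto
    then obtain N where N: "\<And>p n. good p \<Longrightarrow> refines n p (N p n)" by metis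
    \<comment> \<open>Besides the chosen refinements, \<open>c\<close> crosses the points and the
      functions occurring in \<open>p\<close>, which makes the closed set a full rectangle, and it
      adds the operations demanded by \<open>countable_functions_base\<close>.\<close>
    define c where "c p = (\<Union>n. if good p then N p n else {}) \<union>
        fst ` p \<times> (snd ` p \<union> (\<lambda>(\<phi>, \<psi>) k. min (\<phi> k) (\<psi> k)) ` (snd ` p \<times> snd ` p) \<union>
          (\<lambda>(\<phi>, q) k. \<phi> k - of_rat q) ` (snd ` p \<times> UNIV) \<union>
          (\<lambda>(\<phi>, q) k. of_rat q - \<phi> k) ` (snd ` p \<times> UNIV))" for p
    have c: "countable (c p) \<and> c p \<subseteq> ?Z" if p: "finite p" "p \<subseteq> ?Z" for p
    proof
      have 1: "countable (if good p then N p n else {})" for n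
        using N[of p n] by (auto simp: refines_def intro: countable_finite)
      have 2: "countable (snd ` p)" "countable (fst ` p)" using p(1) by (auto intro: countable_finite)
      show "countable (c p)"
        unfolding c_def
        by (intro countable_Un countable_UN countable_SIGMA countable_image 1 2) auto
      have 3: "(if good p then N p n else {}) \<subseteq> ?Z" for n
        using N[of p n] by (auto simp: refines_def)
      have 4: "fst ` p \<subseteq> topspace X" "\<And>\<phi>. \<phi> \<in> snd ` p \<Longrightarrow> continuous_map K euclideanreal \<phi>"
        using p(2) by (auto simp: conditions_def)
      have "snd ` p \<union> (\<lambda>(\<phi>, \<psi>) k. min (\<phi> k) (\<psi> k)) ` (snd ` p \<times> snd ` p) \<union>
          (\<lambda>(\<phi>, q) k. \<phi> k - of_rat q) ` (snd ` p \<times> UNIV) \<union>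
          (\<lambda>(\<phi>, q) k. of_rat q - \<phi> k) ` (snd ` p \<times> UNIV) \<subseteq> {\<phi>. continuous_map K euclideanreal \<phi>}"
        using 4(2) by (auto intro!: continuous_map_real_min continuous_map_diff)
      with 3 4(1) show "c p \<subseteq> ?Z"
        unfolding c_def conditions_def by (intro Un_least UN_least Sigma_mono) auto
    qed
    \<comment> \<open>The added pair makes the rectangle nonempty even if \<open>p0\<close> is
      empty, and puts the constant 1 into \<Phi>.\<close>
    have S0: "countable (insert (x0, \<lambda>_. 1) p0)" "insert (x0, \<lambda>_. 1) p0 \<subseteq> ?Z"
      using p0 x0 by (auto simp: conditions_def intro: countable_finite)
    obtain S where S: "countable S" "insert (x0, \<lambda>_. 1) p0 \<subseteq> S" "S \<subseteq> ?Z"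
        "\<forall>p. finite p \<and> p \<subseteq> S \<longrightarrow> c p \<subseteq> S"
      using countable_closure[where c = c, OF S0(1) c S0(2)] by metis
    have cS: "c p \<subseteq> S" if "finite p" "p \<subseteq> S" for p
      using S(4) that by simp
    define A where "A = fst ` S"
    define \<Phi> where "\<Phi> = snd ` S"
    have AX: "A \<subseteq> topspace X" and \<Phi>c: "\<And>\<phi>. \<phi> \<in> \<Phi> \<Longrightarrow> continuous_map K euclideanreal \<phi>"
      using S(3) by (auto simp: A_def \<Phi>_def conditions_def)
    have prod: "(x, \<phi>) \<in> S" if x\<phi>: "x \<in> A" "\<phi> \<in> \<Phi>" for x \<phi>
    proof -
      obtain u v where uv: "u \<in> S" "v \<in> S" "x = fst u" "\<phi> = snd v"
        using x\<phi> by (auto simp: A_def \<Phi>_def)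
      then have "(x, \<phi>) \<in> c {u, v}" by (auto simp: c_def)
      then show ?thesis using cS[of "{u, v}"] uv(1,2) by blast
    qed
    have x0A: "x0 \<in> A" using S(2) by (force simp: A_def)
    have one: "(\<lambda>_. 1) \<in> \<Phi>" using S(2) by (force simp: \<Phi>_def)
    have c\<Phi>: "\<psi> \<in> \<Phi>" if "(x, \<psi>) \<in> c p" "finite p" "p \<subseteq> S" for x \<psi> p
      using cS[OF that(2,3)] that(1) by (force simp: \<Phi>_def)
    have min: "(\<lambda>k. min (\<phi> k) (\<psi> k)) \<in> \<Phi>" if "\<phi> \<in> \<Phi>" "\<psi> \<in> \<Phi>" for \<phi> \<psi>
      by (rule c\<Phi>[of x0 _ "{(x0, \<phi>), (x0, \<psi>)}"]) (use prod x0A that in \<open>auto simp: c_def\<close>)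
    have lower: "(\<lambda>k. \<phi> k - of_rat q) \<in> \<Phi>" if "\<phi> \<in> \<Phi>" for \<phi> q
      by (rule c\<Phi>[of x0 _ "{(x0, \<phi>)}"]) (use prod x0A that in \<open>auto simp: c_def\<close>)
    have upper: "(\<lambda>k. of_rat q - \<phi> k) \<in> \<Phi>" if "\<phi> \<in> \<Phi>" for \<phi> q
      by (rule c\<Phi>[of x0 _ "{(x0, \<phi>)}"]) (use prod x0A that in \<open>auto simp: c_def\<close>)
    define e where "e = from_nat_into \<Phi>"
    have e: "range e = \<Phi>"
      unfolding e_def using S(1) one by (intro range_from_nat_into) (auto simp: \<Phi>_def)
    define F where "F = (\<lambda>k n. e n k)"
    have F\<Phi>: "\<phi> k = \<phi> k'" if eq: "F k = F k'" and \<phi>: "\<phi> \<in> \<Phi>" for k k' \<phi>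
    proof -
      obtain n where "\<phi> = e n" using e \<phi> by auto
      then show ?thesis using fun_cong[OF eq, of n] by (simp add: F_def)
    qed
    define M where "M = top_of_set (F ` topspace K)"
    have "continuous_map K euclidean F"
      unfolding euclidean_product_topology[symmetric] continuous_map_componentwise_UNIV
      using \<Phi>c e by (auto simp: F_def)
    then have F: "continuous_map K M F" "F ` topspace K = topspace M"
      by (auto simp: M_def continuous_map_in_subtopology)
    have cM: "compact_space M"
      using cK F by (metis compact_space_def image_compactin)
    have mM: "metrizable_space M"
      unfolding M_def by (intro metrizable_space_subtopology metrizable_space_euclidean)
    have Mne: "topspace M \<noteq> {}" using F(2) Kne by blast
    obtain h :: "(nat \<Rightarrow> bool) \<Rightarrow> 'k" where h: "continuous_map cantor_cube K h"
        "F ` range h = topspace M"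
        "\<forall>c n. \<exists>G. openin M G \<and> G \<noteq> {} \<and> G \<subseteq> F ` h ` cylinder {..<n} c"
      using pi_monolithic_cantor_map[OF HK K(2) cM mM Mne F] by metis
    have lift: "\<exists>w. F (h w) = F k" if "k \<in> topspace K" for k
      using that F(2) h(2) by (metis (no_types, lifting) imageE imageI)
    \<comment> \<open>An open subset of the image of a cylinder is turned into a condition: whenever
      \<phi> is positive at a value, the class of this value under \<open>F\<close> is reached by
      \<open>h\<close> from within the cylinder.\<close>
    have large: "\<exists>\<phi>\<in>\<Phi>. \<exists>k\<in>topspace K. 0 < \<phi> k \<and>
        (\<forall>k'\<in>topspace K. 0 < \<phi> k' \<longrightarrow> (\<exists>w\<in>cylinder {..<n} d. F (h w) = F k'))" for d and n :: nat
    proof -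
      obtain G where G: "openin M G" "G \<noteq> {}" "G \<subseteq> F ` h ` cylinder {..<n} d"
        using h(3) by metis
      then obtain G' where G': "open G'" "G = G' \<inter> F ` topspace K"
        unfolding M_def openin_subtopology by auto
      obtain k where k: "k \<in> topspace K" "F k \<in> G'" using G(2) G'(2) by blast
      obtain \<phi> where \<phi>: "\<phi> \<in> \<Phi>" "0 < \<phi> k" "\<And>k'. 0 < \<phi> k' \<Longrightarrow> F k' \<in> G'"
        using countable_functions_base[OF one e min lower upper G'(1), of k] k(2)
        unfolding F_def by blast
      have "\<exists>w\<in>cylinder {..<n} d. F (h w) = F k'" if k': "k' \<in> topspace K" "0 < \<phi> k'" for k'
      proof -
        have "F k' \<in> F ` h ` cylinder {..<n} d" using \<phi>(3) k' G'(2) G(3) by blast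
        then show ?thesis by auto
      qed
      then show ?thesis using \<phi>(1,2) k(1) by blast
    qed
    define eval where "eval v x = h (\<lambda>i. v (x, i))" for v :: "'x \<times> nat \<Rightarrow> bool" and x
    \<comment> \<open>Conditions from \<open>S\<close> see values only through \<open>F\<close>. So
      a map into \<open>K\<close> may be replaced, point by point and regardless of continuity, by
      any lift of its \<open>F\<close>-values through \<open>h\<close>.\<close>
    have transfer: "positive_on p (eval u)"
      if p: "p \<subseteq> S" "positive_on p g" and u: "\<And>x. x \<in> A \<Longrightarrow> F (eval u x) = F (g x)" for p g u
    proof (rule positive_onI)
      fix x \<phi> assume x\<phi>: "(x, \<phi>) \<in> p"
      then have "x \<in> A" "\<phi> \<in> \<Phi>" using p(1) by (force simp: A_def \<Phi>_def)+
      then have "\<phi> (eval u x) = \<phi> (g x)" using F\<Phi> u by blast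
      then show "0 < \<phi> (eval u x)" using positive_onD[OF p(2) x\<phi>] by simp
    qed
    have nbhd: "\<exists>E. finite E \<and> E \<subseteq> topspace X \<times> UNIV \<and> (\<forall>v\<in>cylinder E u. positive_on p (eval v))"
      if "finite p" "p \<subseteq> ?Z" "positive_on p (eval u)" for p u
      using positive_on_cantor_open[OF h(1), of p X u] that by (simp add: eval_def[abs_def])
    \<comment> \<open>\<open>W n\<close> asks for a condition that forces membership in
      \<open>U n\<close>, not for membership itself: for arbitrary \<open>v\<close> the map
      \<open>eval v\<close> is not continuous, hence not in \<open>Cp X K\<close>.\<close>
    define W where "W n = {v. \<exists>p. finite p \<and> p \<subseteq> ?Z \<and> positive_on p (eval v) \<and>
        Cp_positive X K p \<subseteq> U n}" for n
    have dense: "cylinder_dense (topspace X \<times> UNIV) (W n)" for n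
      unfolding cylinder_dense_def
    proof (intro allI impI)
      fix D :: "('x \<times> nat) set" and t :: "'x \<times> nat \<Rightarrow> bool"
      assume D: "finite D \<and> D \<subseteq> topspace X \<times> UNIV"
      then obtain m where m: "snd ` D \<subseteq> {..<m}"
        using finite_subset_lessThan[of "snd ` D"] by blast
      define d where "d x = (\<lambda>i. t (x, i))" for x
      have "\<exists>\<phi> k. \<phi> \<in> \<Phi> \<and> k \<in> topspace K \<and> 0 < \<phi> k \<and>
          (\<forall>k'\<in>topspace K. 0 < \<phi> k' \<longrightarrow> (\<exists>w\<in>cylinder {..<m} (d x). F (h w) = F k'))" for x
        using large[where d = "d x" and n = m] by blast
      then obtain \<phi> k where \<phi>k: "\<And>x. \<phi> x \<in> \<Phi>" "\<And>x. k x \<in> topspace K" "\<And>x. 0 < \<phi> x (k x)"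
          "\<And>x k'. \<lbrakk>k' \<in> topspace K; 0 < \<phi> x k'\<rbrakk> \<Longrightarrow> \<exists>w\<in>cylinder {..<m} (d x). F (h w) = F k'"
        by metis
      \<comment> \<open>Points of \<open>D\<close> outside \<open>A\<close> get no condition. This
        keeps \<open>p\<close>, and with it the refinement \<open>N p n\<close>, inside
        \<open>S\<close>, where such points are never mentioned.\<close>
      define p where "p = (\<lambda>x. (x, \<phi> x)) ` (fst ` D \<inter> A)"
      have p: "finite p" "p \<subseteq> S"
        using D prod \<phi>k(1) by (auto simp: p_def)
      have "positive_on p k" using \<phi>k(3) by (auto simp: p_def positive_on_def)
      then have gp: "good p"
        using p S(3) \<phi>k(2) by (auto simp: good_def)
      let ?p' = "N p n"
      have p': "finite ?p'" "p \<subseteq> ?p'" "?p' \<subseteq> ?Z" "Cp_positive X K ?p' \<noteq> {}"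
          "Cp_positive X K ?p' \<subseteq> U n"
        using N[OF gp, of n] by (auto simp: refines_def)
      have "?p' \<subseteq> c p" using gp by (auto simp: c_def)
      then have p'S: "?p' \<subseteq> S" using cS[OF p] by blast
      obtain f where f: "f \<in> topspace (Cp X K)" "positive_on ?p' f"
        using p'(4) by (auto simp: Cp_positive_def)
      have fK: "f x \<in> topspace K" if "x \<in> topspace X" for x
        using f(1) that by (auto simp: topspace_Cp continuous_map_def)
      \<comment> \<open>At points of both \<open>D\<close> and \<open>A\<close> the refined map
        still satisfies \<open>p\<close>, so its value lifts into the prescribed cylinder. At other
        points of \<open>A\<close> any lift will do, and off \<open>A\<close> the prescribed digits
        themselves.\<close>
      have "\<exists>w. (x \<in> fst ` D \<longrightarrow> w \<in> cylinder {..<m} (d x)) \<and> (x \<in> A \<longrightarrow> F (h w) = F (f x))" for x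
      proof (cases "x \<in> A")
        case True
        then have fx: "f x \<in> topspace K" using AX fK by blast
        show ?thesis
        proof (cases "x \<in> fst ` D")
          case xD: True
          then have "(x, \<phi> x) \<in> ?p'" using True p'(2) by (auto simp: p_def)
          then have "0 < \<phi> x (f x)" using positive_onD[OF f(2)] by blast
          then show ?thesis using \<phi>k(4)[OF fx] by blast
        next
          case False
          then show ?thesis using lift[OF fx] by blast
        qed
      next
        case False
        then show ?thesis by (intro exI[of _ "d x"]) auto
      qed
      then obtain w where w: "\<And>x. x \<in> fst ` D \<Longrightarrow> w x \<in> cylinder {..<m} (d x)"
          "\<And>x. x \<in> A \<Longrightarrow> F (h (w x)) = F (f x)"
        by metis
      define u where "u = (\<lambda>(x, i). w x i)"
      have ew: "eval u x = h (w x)" for x by (simp add: eval_def u_def)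
      have "u \<in> cylinder D t"
        unfolding cylinder_iff
      proof
        fix y assume y: "y \<in> D"
        then have "fst y \<in> fst ` D" "snd y \<in> {..<m}" using m by auto
        then have "w (fst y) (snd y) = d (fst y) (snd y)" using w(1) by (auto simp: cylinder_iff)
        then show "u y = t y" by (simp add: u_def d_def split_beta)
      qed
      moreover have pos: "positive_on ?p' (eval u)"
        by (rule transfer[OF p'S f(2)]) (simp add: ew w(2))
      obtain E where E: "finite E" "E \<subseteq> topspace X \<times> UNIV"
          "\<forall>v\<in>cylinder E u. positive_on ?p' (eval v)"
        using nbhd[OF p'(1,3) pos] by metis
      moreover have "cylinder (D \<union> E) u \<subseteq> W n"
      proof
        fix v assume "v \<in> cylinder (D \<union> E) u"
        then have "v \<in> cylinder E u" by (auto simp: cylinder_iff)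
        then show "v \<in> W n" using E(3) p'(1,3,5) unfolding W_def by blast
      qed
      ultimately show "\<exists>E u. finite E \<and> E \<subseteq> topspace X \<times> UNIV \<and> u \<in> cylinder D t \<and>
          cylinder (D \<union> E) u \<subseteq> W n"
        by blast
    qed
    have "\<exists>w. x \<in> A \<longrightarrow> F (h w) = F (f0 x)" for x
      using lift f0K AX by blast
    then obtain w0 where w0: "\<And>x. x \<in> A \<Longrightarrow> F (h (w0 x)) = F (f0 x)" by metis
    define u0 where "u0 = (\<lambda>(x, i). w0 x i)"
    have pos0: "positive_on p0 (eval u0)"
      by (rule transfer[OF _ p0(3)]) (use S(2) w0 in \<open>auto simp: eval_def u0_def\<close>)
    obtain E0 where E0: "finite E0" "E0 \<subseteq> topspace X \<times> UNIV"
        "\<forall>v\<in>cylinder E0 u0. positive_on p0 (eval v)"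
      using nbhd[OF p0(1,2) pos0] by metis
    obtain v where v: "\<And>i. continuous_map X two_point_space (\<lambda>x. v (x, i))"
        "v \<in> cylinder E0 u0" "\<And>n. v \<in> W n"
      using interpolating_meets_cylinder_dense[where U = W and s = u0,
          OF interpolating_power[OF I] dense E0(1,2)]
      by blast
    define f where "f = restrict (eval v) (topspace X)"
    have "continuous_map X cantor_cube (\<lambda>x i. v (x, i))"
      using v(1) by (simp add: continuous_map_componentwise_UNIV)
    then have "continuous_map X K (eval v)"
      using continuous_map_compose[OF _ h(1)] by (simp add: eval_def[abs_def] o_def)
    then have fC: "f \<in> topspace (Cp X K)"
      by (simp add: f_def topspace_Cp continuous_map_eq)
    have fp: "f \<in> Cp_positive X K p" if p: "p \<subseteq> ?Z" "positive_on p (eval v)" for p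
    proof -
      have "positive_on p f"
      proof (rule positive_onI)
        fix x \<phi> assume "(x, \<phi>) \<in> p"
        moreover from this have "x \<in> topspace X" using p(1) by (auto simp: conditions_def)
        ultimately show "0 < \<phi> (f x)" using positive_onD[OF p(2)] by (simp add: f_def)
      qed
      then show ?thesis using fC by (simp add: Cp_positive_iff)
    qed
    have "f \<in> U n" for n
    proof -
      obtain p where p: "p \<subseteq> ?Z" "positive_on p (eval v)" "Cp_positive X K p \<subseteq> U n"
        using v(3)[of n] unfolding W_def by blast
      then show ?thesis using fp[OF p(1,2)] by blast
    qed
    moreover have "f \<in> V"
      using fp[OF p0(2)] E0(3) v(2) p0(4) by blast
    ultimately show ?thesis by blast
  qed
  then show "Cp X K closure_of (\<Inter>n. U n) = topspace (Cp X K)"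
    unfolding dense_intersects_open by blast
qed


section \<open>Test spaces\<close>

text \<open>Images of finite unions of cylinders are countably many compact sets, and one of them
  fits between any point and any neighbourhood of it. Urysohn functions for the disjoint pairs among
  them therefore separate points; by compactness they embed \<open>K\<close> into a countable power
  of the reals.\<close>

lemma metrizable_Hausdorff_cantor_image:
  fixes q :: "(nat \<Rightarrow> bool) \<Rightarrow> 'k"
  assumes q: "continuous_map cantor_cube K q" "range q = topspace K" and K: "Hausdorff_space K"
  shows "metrizable_space K"
proof -
  have cK: "compact_space K"
    using image_compactin[OF _ q(1), of UNIV] compact_space_cantor_cube q(2)
    by (simp add: compact_space_def)
  have nK: "normal_space K"
    using cK K compact_Hausdorff_or_regular_imp_normal_space by blast
  define Cyl where "Cyl = (\<Union>n. range (cylinder {..<n}) :: (nat \<Rightarrow> bool) set set)"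
  have "countable (range (cylinder {..<n}) :: (nat \<Rightarrow> bool) set set)" for n :: nat
  proof -
    have "cylinder {..<n} c = cylinder {..<n} (\<lambda>i. i \<in> {i. i < n \<and> c i})" for c :: "nat \<Rightarrow> bool"
      by (auto simp: cylinder_def)
    then have "range (cylinder {..<n}) \<subseteq> (\<lambda>s. cylinder {..<n} (\<lambda>i. i \<in> s)) ` Pow {..<n}"
      by blast
    then show ?thesis
      by (meson countable_finite finite_Pow_iff finite_imageI finite_lessThan finite_subset)
  qed
  then have "countable Cyl" unfolding Cyl_def by blast
  define \<K> where "\<K> = (\<lambda>\<F>. q ` \<Union>\<F>) ` {\<F>. finite \<F> \<and> \<F> \<subseteq> Cyl}"
  have c\<K>: "countable \<K>"
    unfolding \<K>_def using countable_Collect_finite_subset[OF \<open>countable Cyl\<close>] by blast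
  have closed: "closedin K C" if C: "C \<in> \<K>" for C
  proof -
    obtain \<F> where \<F>: "finite \<F>" "\<F> \<subseteq> Cyl" "C = q ` \<Union>\<F>" using C by (auto simp: \<K>_def)
    have "closedin cantor_cube (cylinder J c)" if "finite J" for J :: "nat set" and c
    proof -
      have "openin cantor_cube (- cylinder J c)"
        unfolding openin_cantor_cube_iff
      proof
        fix d assume d: "d \<in> - cylinder J c"
        have "cylinder J d \<subseteq> - cylinder J c"
          using d by (auto simp: cylinder_def)
        then show "\<exists>I. finite I \<and> cylinder I d \<subseteq> - cylinder J c" using that by blast
      qed
      then show ?thesis by (simp add: closedin_def Compl_eq_Diff_UNIV)
    qed
    then have "closedin cantor_cube B" if "B \<in> \<F>" for B
      using that \<F>(2) by (auto simp: Cyl_def)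
    then have "closedin cantor_cube (\<Union>\<F>)" using \<F>(1) by (intro closedin_Union)
    then have "compactin cantor_cube (\<Union>\<F>)"
      using closedin_compact_space compact_space_cantor_cube by blast
    then have "compactin K C" using \<F>(3) image_compactin q(1) by blast
    then show ?thesis using K compactin_imp_closedin by blast
  qed
  have fit: "\<exists>C\<in>\<K>. k \<in> C \<and> C \<subseteq> U" if U: "openin K U" "k \<in> U" for k U
  proof -
    have "k \<in> topspace K" using U openin_subset by blast
    then have "closedin cantor_cube {c. q c = k}"
      using closedin_continuous_map_preimage[OF q(1), of "{k}"] K
      by (simp add: closedin_Hausdorff_singleton)
    then have cpt: "compactin cantor_cube {c. q c = k}"
      using closedin_compact_space compact_space_cantor_cube by blast
    let ?G = "{B \<in> Cyl. q ` B \<subseteq> U}"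
    have "{c. q c = k} \<subseteq> \<Union>?G"
    proof
      fix c assume "c \<in> {c. q c = k}"
      then obtain n where "q ` cylinder {..<n} c \<subseteq> U"
        using continuous_map_cantorE[OF q(1) U(1), of c] U(2) by auto
      then show "c \<in> \<Union>?G" unfolding Cyl_def by (auto intro: cylinder_self)
    qed
    moreover have "openin cantor_cube B" if "B \<in> ?G" for B
      using that by (auto simp: Cyl_def openin_cylinder)
    ultimately have "\<exists>\<F>. finite \<F> \<and> \<F> \<subseteq> ?G \<and> {c. q c = k} \<subseteq> \<Union>\<F>"
      by (intro compactinD[OF cpt])
    then obtain \<F> where \<F>: "finite \<F>" "\<F> \<subseteq> ?G" "{c. q c = k} \<subseteq> \<Union>\<F>"
      by (elim exE conjE)
    obtain c where c: "q c = k" using \<open>k \<in> topspace K\<close> q(2) by (metis imageE)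
    have "q ` \<Union>\<F> \<in> \<K>" using \<F> by (auto simp: \<K>_def)
    moreover have "k \<in> q ` \<Union>\<F>" using c \<F>(3) by blast
    moreover have "q ` \<Union>\<F> \<subseteq> U" using \<F>(2) by blast
    ultimately show ?thesis by (intro bexI[of _ "q ` \<Union>\<F>"] conjI)
  qed
  define D where "D = {(C, C'). C \<in> \<K> \<and> C' \<in> \<K> \<and> disjnt C C'}"
  have "D \<subseteq> \<K> \<times> \<K>" by (auto simp: D_def)
  then have cD: "countable D" using c\<K> by (meson countable_SIGMA countable_subset)
  have "{} \<in> \<K>" by (auto simp: \<K>_def)
  then have neD: "D \<noteq> {}" by (auto simp: D_def disjnt_def)
  have "\<exists>f. continuous_map K euclideanreal f \<and> f ` fst P \<subseteq> {0} \<and> f ` snd P \<subseteq> {1}" if "P \<in> D" for P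
  proof -
    have "closedin K (fst P)" "closedin K (snd P)" "disjnt (fst P) (snd P)"
      using that closed by (auto simp: D_def)
    then show ?thesis using Urysohn_lemma_alt[OF nK, of "fst P" "snd P" 0 1] by metis
  qed
  then obtain f where f: "\<And>P. P \<in> D \<Longrightarrow> continuous_map K euclideanreal (f P)"
      "\<And>P. P \<in> D \<Longrightarrow> f P ` fst P \<subseteq> {0} \<and> f P ` snd P \<subseteq> {1}"
    by metis
  define F where "F = (\<lambda>k n. f (from_nat_into D n) k)"
  have "continuous_map K euclidean F"
    unfolding euclidean_product_topology[symmetric] continuous_map_componentwise_UNIV
    using f(1) from_nat_into[OF neD] by (simp add: F_def)
  moreover have "inj_on F (topspace K)"
  proof (rule inj_onI, rule ccontr)
    fix k l assume kl: "k \<in> topspace K" "l \<in> topspace K" "F k = F l" "k \<noteq> l"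
    then obtain U V where UV: "openin K U" "openin K V" "k \<in> U" "l \<in> V" "disjnt U V"
      using K unfolding Hausdorff_space_def by blast
    obtain C C' where C: "C \<in> \<K>" "k \<in> C" "C \<subseteq> U" "C' \<in> \<K>" "l \<in> C'" "C' \<subseteq> V"
      using fit[OF UV(1,3)] fit[OF UV(2,4)] by blast
    then have P: "(C, C') \<in> D" using UV(5) by (auto simp: D_def disjnt_def)
    then obtain n where "from_nat_into D n = (C, C')" using cD from_nat_into_surj by metis
    then have "f (C, C') k = f (C, C') l" using fun_cong[OF kl(3), of n] by (simp add: F_def)
    moreover have "f (C, C') k = 0" "f (C, C') l = 1" using f(2)[OF P] C by auto
    ultimately show False by simp
  qed
  ultimately have "embedding_map K euclidean F"
    using cK by (simp add: continuous_imp_embedding_map)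
  then have "K homeomorphic_space top_of_set (F ` topspace K)"
    using embedding_map_imp_homeomorphic_space by blast
  then show ?thesis
    using homeomorphic_metrizable_space metrizable_space_subtopology metrizable_space_euclidean
    by blast
qed

text \<open>The points of the test space are row indices, not elements of the cube, so that the
  space can be carried to any type with enough elements. Apart from \<open>P\<close>, the two
  clauses are dual to each other.\<close>

definition saturated_matrix :: "'x set \<Rightarrow> ('x \<Rightarrow> 'i \<Rightarrow> bool) \<Rightarrow> bool"
  where "saturated_matrix P e \<longleftrightarrow>
    (\<forall>S s. countable S \<and> S \<subseteq> P \<longrightarrow> (\<exists>i. \<forall>x\<in>S. e x i = s x)) \<and>
    (\<forall>A z. countable A \<longrightarrow> (\<exists>x\<in>P. \<forall>i\<in>A. e x i = z i))"

lemma saturated_matrix_column: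
  assumes "saturated_matrix P e" "countable S" "S \<subseteq> P"
  shows "\<exists>i. \<forall>x\<in>S. e x i = s x"
  using assms(1)[unfolded saturated_matrix_def, THEN conjunct1, rule_format, OF conjI[OF assms(2,3)]] .

lemma saturated_matrix_row:
  assumes "saturated_matrix P e" "countable A"
  shows "\<exists>x\<in>P. \<forall>i\<in>A. e x i = z i"
  using assms(1)[unfolded saturated_matrix_def, THEN conjunct2, rule_format, OF assms(2)] .

text \<open>A binary sequence codes a sequence of points, a sequence of values and a tag. Rows and columns
  prescribe each other's entries; a row may be overruled by the columns, which is avoided by choosing
  its tag, by diagonalization, so that none of the countably many relevant columns mentions it.\<close>

lemma saturated_matrix_exists:
  "\<exists>e :: (nat \<Rightarrow> bool) \<Rightarrow> (nat \<Rightarrow> bool) \<Rightarrow> bool. saturated_matrix UNIV e"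
proof -
  define comp where "comp k r = (\<lambda>m. r (prod_encode (k, m)))" for k and r :: "nat \<Rightarrow> bool"
  define pts where "pts r n = comp (Suc (Suc n)) r" for r n
  define val where "val r = comp 0 r" for r
  define tag where "tag r = comp (Suc 0) r" for r
  have code: "\<exists>r. pts r = \<sigma> \<and> val r = b \<and> tag r = t" for \<sigma> :: "nat \<Rightarrow> nat \<Rightarrow> bool" and b t
  proof -
    define s where "s k = (case k of 0 \<Rightarrow> b | Suc 0 \<Rightarrow> t | Suc (Suc n) \<Rightarrow> \<sigma> n)" for k
    define r where "r j = (case prod_decode j of (k, m) \<Rightarrow> s k m)" for j
    have "comp k r = s k" for k by (simp add: comp_def r_def)
    then show ?thesis
      by (intro exI[of _ r]) (simp add: pts_def val_def tag_def s_def fun_eq_iff)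
  qed
  \<comment> \<open>Column \<open>i\<close> has precedence over row \<xi>. \<open>LEAST\<close>
    gives repeated entries of a list a single value; the values to be realized depend on the entry
    alone, so it is the right one.\<close>
  define e where "e \<xi> i = (if \<exists>n. pts i n = \<xi> then val i (LEAST n. pts i n = \<xi>)
      else if \<exists>n. pts \<xi> n = i then val \<xi> (LEAST n. pts \<xi> n = i) else False)" for \<xi> i
  have col: "\<exists>i. \<forall>n. e (\<sigma> n) i = s (\<sigma> n)" for \<sigma> :: "nat \<Rightarrow> nat \<Rightarrow> bool" and s
  proof -
    obtain i where i: "pts i = \<sigma>" "val i = (\<lambda>n. s (\<sigma> n))" using code by metis
    have "e (\<sigma> n) i = s (\<sigma> n)" for n
    proof -
      have "\<sigma> (LEAST m. \<sigma> m = \<sigma> n) = \<sigma> n" by (rule LeastI) simp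
      then show ?thesis by (auto simp: e_def i)
    qed
    then show ?thesis by blast
  qed
  have row: "\<exists>\<xi>. \<forall>n. e \<xi> (a n) = z (a n)" for a :: "nat \<Rightarrow> nat \<Rightarrow> bool" and z
  proof -
    \<comment> \<open>Bit \<open>prod_encode (m, n)\<close> of \<open>t\<close> differs from the
      same bit of the tag of the \<open>n\<close>-th point listed by column \<open>a m\<close>, so
      no point with tag \<open>t\<close> is on any of these lists.\<close>
    define t where "t k = (\<not> tag (case prod_decode k of (m, n) \<Rightarrow> pts (a m) n) k)" for k
    obtain \<xi> where \<xi>: "pts \<xi> = a" "val \<xi> = (\<lambda>n. z (a n))" "tag \<xi> = t" using code by metis
    have ne: "pts (a m) n \<noteq> \<xi>" for m n
    proof
      assume "pts (a m) n = \<xi>"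
      then have "t (prod_encode (m, n)) = (\<not> tag \<xi> (prod_encode (m, n)))"
        by (simp add: t_def)
      then show False using \<xi>(3) by simp
    qed
    have "e \<xi> (a n) = z (a n)" for n
    proof -
      have "a (LEAST m. a m = a n) = a n" by (rule LeastI) simp
      then show ?thesis using ne by (auto simp: e_def \<xi>)
    qed
    then show ?thesis by blast
  qed
  have "saturated_matrix UNIV e"
    unfolding saturated_matrix_def
  proof (intro conjI allI impI)
    fix S :: "(nat \<Rightarrow> bool) set" and s :: "(nat \<Rightarrow> bool) \<Rightarrow> bool"
    assume S: "countable S \<and> S \<subseteq> UNIV"
    show "\<exists>i. \<forall>x\<in>S. e x i = s x"
    proof (cases "S = {}")
      case False
      then have "range (from_nat_into S) = S" using S by (simp add: range_from_nat_into)
      then show ?thesis using col[of "from_nat_into S" s] by (metis rangeE)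
    qed auto
  next
    fix A :: "(nat \<Rightarrow> bool) set" and z :: "(nat \<Rightarrow> bool) \<Rightarrow> bool"
    assume A: "countable A"
    show "\<exists>x\<in>UNIV. \<forall>i\<in>A. e x i = z i"
    proof (cases "A = {}")
      case False
      then have "range (from_nat_into A) = A" using A by (simp add: range_from_nat_into)
      then show ?thesis using row[of "from_nat_into A" z] by (metis UNIV_I rangeE)
    qed auto
  qed
  then show ?thesis by blast
qed

lemma saturated_matrix_inj_image:
  assumes e: "saturated_matrix UNIV e" and \<iota>: "inj \<iota>"
  shows "saturated_matrix (range \<iota>) (\<lambda>x. e (inv \<iota> x))"
  unfolding saturated_matrix_def
proof (intro conjI allI impI)
  fix S s assume S: "countable S \<and> S \<subseteq> range \<iota>"
  then obtain i where i: "\<forall>r\<in>inv \<iota> ` S. e r i = s (\<iota> r)"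
    using saturated_matrix_column[OF e, of "inv \<iota> ` S" "\<lambda>r. s (\<iota> r)"] by auto
  then have "\<forall>x\<in>S. e (inv \<iota> x) i = s x" using S by (auto simp: f_inv_into_f subset_iff)
  then show "\<exists>i. \<forall>x\<in>S. e (inv \<iota> x) i = s x" by blast
next
  fix A z assume "countable (A :: 'b set)"
  then obtain r where "\<forall>i\<in>A. e r i = z i"
    using saturated_matrix_row[OF e, of A z] by blast
  then show "\<exists>x\<in>range \<iota>. \<forall>i\<in>A. e (inv \<iota> x) i = z i"
    using \<iota> by (intro bexI[of _ "\<iota> r"]) auto
qed

section \<open>The test space of a saturated matrix\<close>

definition matrix_space :: "'x set \<Rightarrow> ('x \<Rightarrow> 'i \<Rightarrow> bool) \<Rightarrow> 'x topology"
  where "matrix_space P e = pullback_topology P e cantor_cube"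

definition matrix_box :: "'x set \<Rightarrow> ('x \<Rightarrow> 'i \<Rightarrow> bool) \<Rightarrow> 'i set \<Rightarrow> ('i \<Rightarrow> bool) \<Rightarrow> 'x set"
  where "matrix_box P e J z = {x \<in> P. e x \<in> cylinder J z}"

lemma matrix_box_iff: "x \<in> matrix_box P e J z \<longleftrightarrow> x \<in> P \<and> (\<forall>i\<in>J. e x i = z i)"
  by (simp add: matrix_box_def cylinder_iff)

lemma matrix_box_cong: "(\<And>i. i \<in> J \<Longrightarrow> z i = z' i) \<Longrightarrow> matrix_box P e J z = matrix_box P e J z'"
  by (auto simp: matrix_box_iff)

lemma matrix_box_antimono: "J \<subseteq> J' \<Longrightarrow> matrix_box P e J' z \<subseteq> matrix_box P e J z"
  unfolding matrix_box_def using cylinder_antimono[of J J' z] by blast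

lemma topspace_matrix_space [simp]: "topspace (matrix_space P e) = P"
  by (simp add: matrix_space_def topspace_pullback_topology)

lemma openin_matrix_box:
  assumes "finite J"
  shows "openin (matrix_space P e) (matrix_box P e J z)"
  unfolding matrix_space_def openin_pullback_topology
  by (intro exI[of _ "cylinder J z"] conjI openin_cylinder assms) (auto simp: matrix_box_def)

lemma openin_matrix_space_contains_box:
  assumes "openin (matrix_space P e) U" "x \<in> U"
  shows "\<exists>J. finite J \<and> matrix_box P e J (e x) \<subseteq> U"
proof -
  obtain W where W: "openin cantor_cube W" "U = e -` W \<inter> P"
    using assms(1) unfolding matrix_space_def openin_pullback_topology by blast
  then obtain J where "finite J" "cylinder J (e x) \<subseteq> W"
    using assms(2) unfolding openin_cantor_cube_iff by blast
  then show ?thesis using W(2) by (intro exI[of _ J]) (auto simp: matrix_box_def)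
qed

lemma closedin_matrix_box:
  assumes "finite J"
  shows "closedin (matrix_space P e) (matrix_box P e J z)"
proof -
  have "openin (matrix_space P e) (P - matrix_box P e J z)"
  proof (subst openin_subopen, intro ballI)
    fix x assume x: "x \<in> P - matrix_box P e J z"
    have "matrix_box P e J (e x) \<inter> matrix_box P e J z = {}"
      using x by (auto simp: matrix_box_iff)
    moreover have "x \<in> matrix_box P e J (e x)" using x by (simp add: matrix_box_iff)
    ultimately show "\<exists>T. openin (matrix_space P e) T \<and> x \<in> T \<and> T \<subseteq> P - matrix_box P e J z"
      using openin_matrix_box[OF assms, of P e "e x"]
      by (intro exI[of _ "matrix_box P e J (e x)"]) (auto simp: matrix_box_iff)
  qed
  then show ?thesis by (auto simp: closedin_def matrix_box_iff)
qed

lemma saturated_matrix_box_nonempty: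
  assumes "saturated_matrix P e" "countable J"
  shows "matrix_box P e J z \<noteq> {}"
proof -
  obtain x where "x \<in> P" "\<forall>i\<in>J. e x i = z i"
    using saturated_matrix_row[OF assms, of z] by blast
  then have "x \<in> matrix_box P e J z" by (simp add: matrix_box_iff)
  then show ?thesis by blast
qed

lemma saturated_matrix_separates:
  assumes "saturated_matrix P e" "x \<in> P" "y \<in> P" "x \<noteq> y"
  shows "\<exists>i. e x i \<noteq> e y i"
  using saturated_matrix_column[OF assms(1), of "{x, y}" "\<lambda>w. w = x"] assms(2-4) by auto

lemma matrix_space_quasi_totally_disconnected:
  assumes "saturated_matrix P e"
  shows "quasi_totally_disconnected_space (matrix_space P e)"
  unfolding quasi_totally_disconnected_space_def
proof
  fix x assume "x \<in> topspace (matrix_space P e)"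
  then have x: "x \<in> P" by simp
  let ?C = "{C. closedin (matrix_space P e) C \<and> openin (matrix_space P e) C \<and> x \<in> C}"
  have box: "matrix_box P e J (e x) \<in> ?C" if "finite J" for J
    using x that by (simp add: matrix_box_iff openin_matrix_box closedin_matrix_box)
  have "y = x" if y: "y \<in> \<Inter>?C" for y
  proof (rule ccontr)
    assume "y \<noteq> x"
    have "y \<in> P" using y box[of "{}"] by (auto simp: matrix_box_iff)
    then obtain i where i: "e x i \<noteq> e y i"
      using saturated_matrix_separates[OF assms x] \<open>y \<noteq> x\<close> by metis
    have "y \<in> matrix_box P e {i} (e x)" using y box[of "{i}"] by blast
    then show False using i by (simp add: matrix_box_iff)
  qed
  then show "\<Inter>?C = {x}" by blast
qed

lemma matrix_space_tychonoff:
  assumes "saturated_matrix P e"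
  shows "tychonoff_space (matrix_space P e)"
  unfolding tychonoff_space_def
proof
  let ?X = "matrix_space P e"
  show "t1_space ?X"
    unfolding t1_space_def
  proof (intro ballI impI)
    fix x y assume xy: "x \<in> topspace ?X" "y \<in> topspace ?X" "x \<noteq> y"
    then obtain i where "e x i \<noteq> e y i"
      using saturated_matrix_separates[OF assms] by (metis topspace_matrix_space)
    then show "\<exists>U. openin ?X U \<and> x \<in> U \<and> y \<notin> U"
      using xy openin_matrix_box[of "{i}" P e "e x"]
      by (intro exI[of _ "matrix_box P e {i} (e x)"]) (auto simp: matrix_box_iff)
  qed
  show "completely_regular_space ?X"
    unfolding completely_regular_space_alt'
  proof (intro allI impI)
    fix S x assume S: "openin ?X S" "x \<in> S"
    obtain J where J: "finite J" "matrix_box P e J (e x) \<subseteq> S"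
      using openin_matrix_space_contains_box[OF S] by blast
    have x: "x \<in> P" using S openin_subset by fastforce
    let ?f = "\<lambda>y. if y \<in> matrix_box P e J (e x) then 0 else 1 :: real"
    have "continuous_map ?X euclideanreal ?f"
      using openin_matrix_box[OF J(1)] closedin_matrix_box[OF J(1)]
      by (intro continuous_map_if_clopen) auto
    moreover have "?f x = 0" using x by (simp add: matrix_box_iff)
    moreover have "?f ` (topspace ?X - S) \<subseteq> {1}" using J(2) by auto
    ultimately show "\<exists>f. continuous_map ?X euclideanreal f \<and> f x = 0 \<and> f ` (topspace ?X - S) \<subseteq> {1}"
      by blast
  qed
qed

text \<open>All points involved form a countable set, so one column realizes the whole of
  \<open>s\<close> on it, and columns are continuous.\<close>

lemma matrix_space_interpolating:
  assumes "saturated_matrix P e"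
  shows "interpolating P {f. continuous_map (matrix_space P e) two_point_space f}"
  unfolding interpolating_def
proof (intro allI impI)
  fix s :: "'a \<Rightarrow> bool" and C and D :: "nat \<Rightarrow> 'a set"
  assume A: "finite C \<and> C \<subseteq> P \<and> (\<forall>n. finite (D n) \<and> D n \<subseteq> P) \<and> disjoint_family D"
  let ?S = "C \<union> (\<Union>n. D n)"
  have "countable ?S" "?S \<subseteq> P" using A by (auto intro: countable_finite)
  then obtain i where i: "\<forall>x\<in>?S. e x i = s x"
    using saturated_matrix_column[OF assms] by metis
  have "continuous_map (matrix_space P e) two_point_space (\<lambda>x. e x i)"
    unfolding continuous_map_def
  proof (intro conjI allI impI)
    fix U :: "bool set"
    have "{x \<in> topspace (matrix_space P e). e x i \<in> U} = (\<Union>b\<in>U. matrix_box P e {i} (\<lambda>_. b))"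
      by (auto simp: matrix_box_iff)
    then show "openin (matrix_space P e) {x \<in> topspace (matrix_space P e). e x i \<in> U}"
      using openin_matrix_box[of "{i}" P e] by auto
  qed simp
  moreover have "(\<lambda>x. e x i) \<in> cylinder C s" using i by (simp add: cylinder_iff)
  moreover have "{n. (\<lambda>x. e x i) \<in> cylinder (D n) s} = UNIV" using i by (auto simp: cylinder_iff)
  ultimately show "\<exists>f\<in>{f. continuous_map (matrix_space P e) two_point_space f}.
      f \<in> cylinder C s \<and> infinite {n. f \<in> cylinder (D n) s}"
    by (intro bexI[of _ "\<lambda>x. e x i"]) auto
qed

text \<open>If a box outside the closure of \<open>Q\<close> were compatible with the trace on \<open>A\<close> of a box inside
  \<open>Q\<close>, then a reflection of the inner box into \<open>A\<close> would be compatible with the whole outer box.\<close>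

lemma matrix_space_countable_support:
  assumes e: "saturated_matrix P e"
  shows "\<exists>A. countable A \<and> (\<forall>J z. finite J \<and> matrix_box P e J z \<subseteq> Q \<longrightarrow>
    matrix_box P e (J \<inter> A) z \<subseteq> matrix_space P e closure_of Q)"
proof -
  \<comment> \<open>Finite partial assignments are coded as finite relations, to which
    \<open>countable_closure\<close> applies directly; an inconsistent relation has empty
    \<open>B\<close>.\<close>
  define B where "B p = {x \<in> P. \<forall>i b. (i, b) \<in> p \<longrightarrow> e x i = b}" for p
  define refl where "refl p q \<longleftrightarrow> finite q \<and> p \<subseteq> q \<and> B q \<noteq> {} \<and> B q \<subseteq> Q" for p q
  \<comment> \<open>The product with \<open>UNIV\<close> puts both values at each coordinate of
    \<open>A\<close> into the closed set, so every finite assignment on \<open>A\<close> is among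
    its finite subsets.\<close>
  define c where "c p = (if Ex (refl p) then Eps (refl p) else {}) \<union> fst ` p \<times> UNIV" for p
  have refl: "refl p (Eps (refl p))" if "Ex (refl p)" for p
    using that by (rule someI_ex)
  have "countable (c p) \<and> c p \<subseteq> UNIV" if "finite p" for p
  proof -
    have "finite (Eps (refl p))" if "Ex (refl p)"
      using refl[OF that] by (simp add: refl_def)
    then show ?thesis using that by (auto simp: c_def intro: countable_finite)
  qed
  then have c: "\<And>p. \<lbrakk>finite p; p \<subseteq> UNIV\<rbrakk> \<Longrightarrow> countable (c p) \<and> c p \<subseteq> UNIV" by blast
  obtain S where S: "countable S" "\<forall>p. finite p \<and> p \<subseteq> S \<longrightarrow> c p \<subseteq> S"
    using countable_closure[where c = c, OF countable_empty c empty_subsetI] by metis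
  define A where "A = fst ` S"
  have SA: "(i, b) \<in> S" if i: "i \<in> A" for i b
  proof -
    obtain b' where b': "(i, b') \<in> S" using i by (auto simp: A_def)
    then have "c {(i, b')} \<subseteq> S" using S(2) by simp
    then show ?thesis by (auto simp: c_def)
  qed
  have main: "y \<in> matrix_space P e closure_of Q"
    if J: "finite J" "matrix_box P e J z \<subseteq> Q" and y: "y \<in> matrix_box P e (J \<inter> A) z" for J z y
    unfolding in_closure_of
  proof (intro conjI allI impI)
    show "y \<in> topspace (matrix_space P e)" using y by (simp add: matrix_box_iff)
    fix T assume T: "y \<in> T \<and> openin (matrix_space P e) T"
    then obtain J' where J': "finite J'" "matrix_box P e J' (e y) \<subseteq> T"
      using openin_matrix_space_contains_box by metis
    define p where "p = (\<lambda>i. (i, e y i)) ` ((J \<union> J') \<inter> A)"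
    have p: "finite p" "p \<subseteq> S" using J(1) J'(1) SA by (auto simp: p_def)
    \<comment> \<open>Adding \<open>z\<close> on all of \<open>J\<close> is one way to push
      \<open>p\<close> into \<open>Q\<close>, hence the choice \<open>Eps\<close> is defined. Unlike
      this witness, the chosen relation mentions only coordinates in \<open>A\<close>.\<close>
    have "refl p (p \<union> (\<lambda>i. (i, z i)) ` J)"
      unfolding refl_def
    proof (intro conjI)
      have "countable (J \<union> J')" using J(1) J'(1) by (simp add: countable_finite)
      then obtain x where x: "x \<in> P" "\<forall>i\<in>J \<union> J'. e x i = (if i \<in> A then e y i else z i)"
        using saturated_matrix_row[OF e, of _ "\<lambda>i. if i \<in> A then e y i else z i"] by blast
      have "e x i = z i" if "i \<in> J" for i
        using x(2) y that by (auto simp: matrix_box_iff)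
      then have "x \<in> B (p \<union> (\<lambda>i. (i, z i)) ` J)"
        using x by (auto simp: B_def p_def)
      then show "B (p \<union> (\<lambda>i. (i, z i)) ` J) \<noteq> {}" by blast
      have "B (p \<union> (\<lambda>i. (i, z i)) ` J) \<subseteq> matrix_box P e J z"
      proof
        fix x assume x: "x \<in> B (p \<union> (\<lambda>i. (i, z i)) ` J)"
        have "e x i = z i" if "i \<in> J" for i
        proof -
          have "(i, z i) \<in> p \<union> (\<lambda>i. (i, z i)) ` J" using that by blast
          then show ?thesis using x unfolding B_def by blast
        qed
        then show "x \<in> matrix_box P e J z" using x by (simp add: B_def matrix_box_iff)
      qed
      then show "B (p \<union> (\<lambda>i. (i, z i)) ` J) \<subseteq> Q" using J(2) by blast
    qed (use p J in auto)
    then have ex: "Ex (refl p)" by blast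
    let ?q = "Eps (refl p)"
    have q: "finite ?q" "p \<subseteq> ?q" "B ?q \<noteq> {}" "B ?q \<subseteq> Q"
      using refl[OF ex] by (auto simp: refl_def)
    have "?q \<subseteq> c p" using ex by (auto simp: c_def)
    then have qS: "?q \<subseteq> S" using S(2) p by blast
    obtain x0 where x0: "x0 \<in> B ?q" using q(3) by blast
    \<comment> \<open>A row that follows \<open>x0\<close> on \<open>A\<close> and \<open>y\<close>
      elsewhere lies in \<open>Q\<close>, since \<open>?q\<close> lives on \<open>A\<close>, and in
      \<open>T\<close>, since \<open>?q\<close> contains the values of \<open>y\<close> on the part
      of \<open>J'\<close> in \<open>A\<close>.\<close>
    have "countable (fst ` ?q \<union> J')" using q(1) J'(1) by (simp add: countable_finite)
    then obtain x1 where x1: "x1 \<in> P" "\<forall>i\<in>fst ` ?q \<union> J'. e x1 i = (if i \<in> A then e x0 i else e y i)"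
      using saturated_matrix_row[OF e, of _ "\<lambda>i. if i \<in> A then e x0 i else e y i"] by blast
    have "e x1 i = b" if ib: "(i, b) \<in> ?q" for i b
    proof -
      have "i \<in> A" using ib qS by (force simp: A_def)
      moreover have "i \<in> fst ` ?q" using ib by force
      ultimately have "e x1 i = e x0 i" using x1(2) by simp
      then show ?thesis using x0 ib by (auto simp: B_def)
    qed
    then have "x1 \<in> Q" using q(4) x1(1) by (auto simp: B_def)
    moreover have "e x1 i = e y i" if i: "i \<in> J'" for i
    proof (cases "i \<in> A")
      case True
      then have "(i, e y i) \<in> ?q" using i q(2) by (auto simp: p_def)
      then have "e x0 i = e y i" using x0 by (auto simp: B_def)
      then show ?thesis using x1(2) i True by simp
    next
      case False
      then show ?thesis using x1(2) i by simp
    qed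
    then have "x1 \<in> T" using J'(2) x1(1) by (auto simp: matrix_box_iff)
    ultimately show "\<exists>y. y \<in> Q \<and> y \<in> T" by blast
  qed
  have "countable A" using S(1) by (simp add: A_def)
  then show ?thesis using main by blast
qed

text \<open>\<open>G z\<close> is the only point in the closures of the images of all boxes around \<open>z\<close>. Uniqueness
  holds because each open set depends, up to closure, on countably many coordinates, on which some
  point of \<open>P\<close> agrees with \<open>z\<close>.\<close>

lemma matrix_space_extension:
  fixes K :: "'k topology" and g :: "'x \<Rightarrow> 'k" and e :: "'x \<Rightarrow> 'i \<Rightarrow> bool"
  assumes e: "saturated_matrix P e" and K: "compact_Hausdorff_space K"
    and g: "continuous_map (matrix_space P e) K g"
  obtains G :: "('i \<Rightarrow> bool) \<Rightarrow> 'k" where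
    "\<And>z J. finite J \<Longrightarrow> G z \<in> K closure_of g ` matrix_box P e J z"
    "\<And>z V. \<lbrakk>openin K V; G z \<in> V\<rbrakk> \<Longrightarrow> \<exists>J. finite J \<and> K closure_of g ` matrix_box P e J z \<subseteq> V"
proof -
  let ?X = "matrix_space P e"
  have cK: "compact_space K" and HK: "Hausdorff_space K"
    using K by (auto simp: compact_Hausdorff_space_def)
  have gK: "g x \<in> topspace K" if "x \<in> P" for x
    using g that by (auto simp: continuous_map_def)
  define L where "L z J = K closure_of g ` matrix_box P e J z" for z J
  define \<C> where "\<C> z = L z ` {J. finite J}" for z
  have mono: "L z J' \<subseteq> L z J" if "J \<subseteq> J'" for z J J'
    unfolding L_def by (intro closure_of_mono image_mono matrix_box_antimono that)
  have closed: "closedin K C" if "C \<in> \<C> z" for C z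
    using that by (auto simp: \<C>_def L_def)
  have directed: "\<exists>C\<in>\<C> z. C \<subseteq> A \<inter> B" if AB: "A \<in> \<C> z" "B \<in> \<C> z" for A B z
  proof -
    obtain J J' where J: "finite J" "A = L z J" "finite J'" "B = L z J'"
      using AB by (auto simp: \<C>_def)
    then have "L z (J \<union> J') \<in> \<C> z" by (auto simp: \<C>_def)
    moreover have "L z (J \<union> J') \<subseteq> A \<inter> B"
      unfolding J(2,4) using mono[of J "J \<union> J'" z] mono[of J' "J \<union> J'" z] by blast
    ultimately show ?thesis by blast
  qed
  have ne: "\<C> z \<noteq> {}" for z by (auto simp: \<C>_def)
  have subset: "\<exists>J. finite J \<and> L z J \<subseteq> V" if "openin K V" "\<Inter>(\<C> z) \<subseteq> V" for z V
  proof -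
    have "\<exists>C\<in>\<C> z. C \<subseteq> V"
      by (rule compact_space_directed_Inter[OF cK closed ne directed that])
    then show ?thesis by (auto simp: \<C>_def)
  qed
  have Lne: "L z J \<noteq> {}" if J: "finite J" for z J
  proof -
    obtain x where "x \<in> matrix_box P e J z"
      using saturated_matrix_box_nonempty[OF e countable_finite[OF J], of z] by blast
    moreover from this have "g x \<in> topspace K" using gK by (simp add: matrix_box_iff)
    ultimately have "g x \<in> L z J"
      unfolding L_def in_closure_of by blast
    then show ?thesis by blast
  qed
  have nonempty: "\<Inter>(\<C> z) \<noteq> {}" for z
    using subset[of "{}" z] Lne by auto
  \<comment> \<open>As \<open>x\<close> and \<open>z\<close> agree on \<open>A\<close>, a box around
    \<open>x\<close> inside \<open>Q\<close>, reduced to its coordinates in \<open>A\<close>, is a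
    box around \<open>z\<close> within the closure of \<open>Q\<close>. Its image stays in the
    closure of the complement of the closure of \<open>V\<close>, which misses
    \<open>V\<close>.\<close>
  have separated: "\<exists>J. finite J \<and> V \<inter> L z J = {}"
    if V: "openin K V" and Q: "Q = {x \<in> P. g x \<in> topspace K - K closure_of V}"
      and A: "\<forall>J z. finite J \<and> matrix_box P e J z \<subseteq> Q \<longrightarrow>
        matrix_box P e (J \<inter> A) z \<subseteq> ?X closure_of Q"
      and x: "x \<in> P" "g x \<notin> K closure_of V" "\<forall>i\<in>A. e x i = z i" for V A x z Q
  proof -
    have "openin K (topspace K - K closure_of V)"
      by (intro openin_diff) auto
    then have "openin ?X Q"
      using openin_continuous_map_preimage[OF g] unfolding Q by fastforce
    moreover have "x \<in> Q" using x gK unfolding Q by simp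
    ultimately obtain J where J: "finite J" "matrix_box P e J (e x) \<subseteq> Q"
      using openin_matrix_space_contains_box[of P e Q x] by blast
    have "matrix_box P e (J \<inter> A) z = matrix_box P e (J \<inter> A) (e x)"
      using x(3) by (intro matrix_box_cong) auto
    also have "\<dots> \<subseteq> ?X closure_of Q" using A J by blast
    finally have "g ` matrix_box P e (J \<inter> A) z \<subseteq> g ` (?X closure_of Q)"
      by (rule image_mono)
    also have "\<dots> \<subseteq> K closure_of (g ` Q)"
      by (rule continuous_map_image_closure_subset[OF g])
    also have "\<dots> \<subseteq> K closure_of (topspace K - K closure_of V)"
      unfolding Q by (intro closure_of_mono) auto
    also have "\<dots> \<subseteq> topspace K - V"
    proof (rule closure_of_minimal)
      show "topspace K - K closure_of V \<subseteq> topspace K - V"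
        using closure_of_subset[OF openin_subset[OF V]] by blast
      show "closedin K (topspace K - V)" using V by blast
    qed
    finally have "L z (J \<inter> A) \<subseteq> topspace K - V"
      unfolding L_def using V by (intro closure_of_minimal) auto
    then show ?thesis using J(1) by (intro exI[of _ "J \<inter> A"]) auto
  qed
  have unique: "p = p'" if p: "p \<in> \<Inter>(\<C> z)" "p' \<in> \<Inter>(\<C> z)" for p p' z
  proof (rule ccontr)
    assume ne: "p \<noteq> p'"
    have "L z {} \<subseteq> topspace K" by (simp add: L_def closure_of_subset_topspace)
    then have pK: "p \<in> topspace K" "p' \<in> topspace K"
      using p by (auto simp: \<C>_def)
    then obtain V W where VW: "openin K V" "openin K W" "p \<in> V" "p' \<in> W" "disjnt V W"
      using HK ne unfolding Hausdorff_space_def by metis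
    \<comment> \<open>Disjoint neighbourhoods are not enough: \<open>g x\<close> has to avoid the
      closure of one of them. Regularity improves the pair to one with disjoint closures.\<close>
    have "W \<inter> K closure_of V = {}"
      using VW(2,5) openin_Int_closure_of_eq_empty[of K W V] by (auto simp: disjnt_def)
    then have "p' \<in> topspace K - K closure_of V" using VW(4) pK by blast
    moreover have "regular_space K" using cK HK compact_Hausdorff_imp_regular_space by blast
    ultimately obtain U U' where U: "openin K U" "openin K U'" "p' \<in> U" "K closure_of V \<subseteq> U'" "disjnt U U'"
      unfolding regular_space_def using closedin_closure_of by metis
    have "U' \<inter> K closure_of U = {}"
      using U(2,5) openin_Int_closure_of_eq_empty[of K U' U] by (auto simp: disjnt_def)
    then have disj: "K closure_of V \<inter> K closure_of U = {}" using U(4) by blast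
    define QV where "QV = {x \<in> P. g x \<in> topspace K - K closure_of V}"
    define QU where "QU = {x \<in> P. g x \<in> topspace K - K closure_of U}"
    obtain A1 where A1: "countable A1" "\<forall>J z. finite J \<and> matrix_box P e J z \<subseteq> QV \<longrightarrow>
        matrix_box P e (J \<inter> A1) z \<subseteq> ?X closure_of QV"
      using matrix_space_countable_support[OF e, of QV] by (elim exE conjE)
    obtain A2 where A2: "countable A2" "\<forall>J z. finite J \<and> matrix_box P e J z \<subseteq> QU \<longrightarrow>
        matrix_box P e (J \<inter> A2) z \<subseteq> ?X closure_of QU"
      using matrix_space_countable_support[OF e, of QU] by (elim exE conjE)
    obtain x where x: "x \<in> P" "\<forall>i\<in>A1 \<union> A2. e x i = z i"
      using saturated_matrix_row[OF e, of "A1 \<union> A2" z] A1(1) A2(1) by auto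
    consider "g x \<notin> K closure_of V" | "g x \<notin> K closure_of U" using disj by blast
    then show False
    proof cases
      case 1
      have "\<exists>J. finite J \<and> V \<inter> L z J = {}"
        by (rule separated[OF VW(1) QV_def A1(2) x(1) 1]) (use x(2) in auto)
      then show False using p(1) VW(3) by (auto simp: \<C>_def)
    next
      case 2
      have "\<exists>J. finite J \<and> U \<inter> L z J = {}"
        by (rule separated[OF U(1) QU_def A2(2) x(1) 2]) (use x(2) in auto)
      then show False using p(2) U(3) by (auto simp: \<C>_def)
    qed
  qed
  have "\<exists>k. k \<in> \<Inter>(\<C> z)" for z using nonempty[of z] by blast
  then obtain G where G: "\<And>z. G z \<in> \<Inter>(\<C> z)" by metis
  show ?thesis
  proof (rule that[of G])
    fix z and J :: "'i set" assume "finite J"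
    then show "G z \<in> K closure_of g ` matrix_box P e J z"
      using G[of z] by (auto simp: \<C>_def L_def)
  next
    fix z V assume V: "openin K V" "G z \<in> V"
    have "\<Inter>(\<C> z) \<subseteq> V"
    proof
      fix k assume "k \<in> \<Inter>(\<C> z)"
      then have "k = G z" using unique G by metis
      then show "k \<in> V" using V(2) by simp
    qed
    then show "\<exists>J. finite J \<and> K closure_of g ` matrix_box P e J z \<subseteq> V"
      using subset[OF V(1)] by (simp add: L_def)
  qed
qed

text \<open>The supports of the preimages of a countable base of \<open>M\<close> add up to a
  countable set \<open>A'\<close>, and \<open>q\<close> is the extension \<open>G\<close> with all
  other coordinates frozen. If \<open>c\<close> copies the row of \<open>x\<close> on
  \<open>A'\<close>, then \<open>f (q c)\<close> is in the closure of every base set around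
  \<open>f (g x)\<close>, hence equal to it. The image of \<open>q\<close> under \<open>f\<close> is
  thus dense, and it is compact.\<close>

lemma matrix_space_dense_image_covered:
  fixes K :: "'k topology" and M :: "'m topology" and g :: "'x \<Rightarrow> 'k" and e :: "'x \<Rightarrow> 'i \<Rightarrow> bool"
  assumes e: "saturated_matrix P e" and K: "compact_Hausdorff_space K"
    and g: "continuous_map (matrix_space P e) K g"
    and M: "compact_space M" "metrizable_space M" and f: "continuous_map K M f"
    and dense: "\<And>V. \<lbrakk>openin M V; V \<noteq> {}\<rbrakk> \<Longrightarrow> \<exists>x\<in>P. f (g x) \<in> V"
  shows "\<exists>q :: (nat \<Rightarrow> bool) \<Rightarrow> 'k. continuous_map cantor_cube K q \<and> f ` range q = topspace M"
proof -
  let ?X = "matrix_space P e"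
  have HM: "Hausdorff_space M" using M(2) by (simp add: metrizable_imp_Hausdorff_space)
  obtain G :: "('i \<Rightarrow> bool) \<Rightarrow> 'k"
    where G: "\<And>z J. finite J \<Longrightarrow> G z \<in> K closure_of g ` matrix_box P e J z"
      "\<And>z V. \<lbrakk>openin K V; G z \<in> V\<rbrakk> \<Longrightarrow> \<exists>J. finite J \<and> K closure_of g ` matrix_box P e J z \<subseteq> V"
    by (rule matrix_space_extension[OF e K g]) metis
  obtain B where B: "base_sequence M B"
    using compact_metrizable_base_sequence[OF M] by blast
  define Q where "Q n = {x \<in> P. f (g x) \<in> B n}" for n
  have "\<exists>A. countable A \<and> (\<forall>J z. finite J \<and> matrix_box P e J z \<subseteq> Q n \<longrightarrow>
      matrix_box P e (J \<inter> A) z \<subseteq> ?X closure_of Q n)" for n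
    by (rule matrix_space_countable_support[OF e])
  then obtain A where A: "\<And>n. countable (A n)"
      "\<And>n J z. \<lbrakk>finite J; matrix_box P e J z \<subseteq> Q n\<rbrakk> \<Longrightarrow> matrix_box P e (J \<inter> A n) z \<subseteq> ?X closure_of Q n"
    by metis
  \<comment> \<open>\<open>undefined\<close> only makes \<open>A'\<close> nonempty, so that it is
    the range of a sequence.\<close>
  define A' where "A' = insert undefined (\<Union>n. A n)"
  have "countable A'" using A(1) by (simp add: A'_def)
  define a where "a = from_nat_into A'"
  have a: "range a = A'"
    unfolding a_def using \<open>countable A'\<close> by (intro range_from_nat_into) (auto simp: A'_def)
  \<comment> \<open>The enumeration may repeat; each coordinate is governed by the first digit that
    lists it.\<close>
  define idx where "idx i = (LEAST n. a n = i)" for i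
  have idx: "a (idx i) = i" if i: "i \<in> A'" for i
  proof -
    obtain n where "a n = i" using i a by (metis rangeE)
    then show ?thesis unfolding idx_def by (rule LeastI)
  qed
  define ext where "ext c = (\<lambda>i. i \<in> A' \<and> c (idx i))" for c
  define q where "q c = G (ext c)" for c
  have qK: "q c \<in> topspace K" for c
    using G(1)[of "{}" "ext c"] by (auto simp: q_def in_closure_of)
  have q: "continuous_map cantor_cube K q"
    unfolding continuous_map_cantor_cube_iff
  proof (intro conjI allI impI)
    show "range q \<subseteq> topspace K" using qK by blast
    fix V c assume V: "openin K V \<and> q c \<in> V"
    then obtain J where J: "finite J" "K closure_of g ` matrix_box P e J (ext c) \<subseteq> V"
      using G(2)[of V "ext c"] by (auto simp: q_def)
    have "q d \<in> V" if d: "d \<in> cylinder (idx ` J) c" for d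
    proof -
      have "ext d i = ext c i" if "i \<in> J" for i
        using d that by (auto simp: ext_def cylinder_iff)
      then have "matrix_box P e J (ext d) = matrix_box P e J (ext c)"
        by (rule matrix_box_cong)
      then show ?thesis
        using G(1)[OF J(1), of "ext d"] J(2) by (auto simp: q_def)
    qed
    then show "\<exists>J. finite J \<and> q ` cylinder J c \<subseteq> V"
      using J(1) by (intro exI[of _ "idx ` J"]) auto
  qed
  have hit: "f (g x) \<in> f ` range q" if x: "x \<in> P" for x
  proof -
    define c where "c n = e x (a n)" for n
    have "f (q c) = f (g x)"
    proof (rule ccontr)
      assume ne: "f (q c) \<noteq> f (g x)"
      have "f (q c) \<in> topspace M" "f (g x) \<in> topspace M"
        using f g qK[of c] x by (auto simp: continuous_map_def Pi_iff)
      then obtain V W where VW: "openin M V" "openin M W" "f (g x) \<in> V" "f (q c) \<in> W" "disjnt V W"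
        using HM ne unfolding Hausdorff_space_def by metis
      obtain n where n: "f (g x) \<in> B n" "B n \<subseteq> V" using base_sequenceD[OF B VW(1,3)] by blast
      have "W \<inter> M closure_of B n = {}"
        using VW(2,5) n(2) openin_Int_closure_of_eq_empty[of M W "B n"] by (auto simp: disjnt_def)
      then have notin: "f (q c) \<notin> M closure_of B n" using VW(4) by blast
      have "openin ?X (Q n)"
        using openin_continuous_map_preimage[OF continuous_map_compose[OF g f] base_sequence_openin[OF B, of n]]
        by (simp add: Q_def)
      moreover have "x \<in> Q n" using x n by (simp add: Q_def)
      ultimately obtain J where J: "finite J" "matrix_box P e J (e x) \<subseteq> Q n"
        using openin_matrix_space_contains_box by metis
      have "ext c i = e x i" if "i \<in> J \<inter> A n" for i
      proof -
        have "i \<in> A'" using that by (auto simp: A'_def)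
        then show ?thesis by (simp add: ext_def c_def idx)
      qed
      then have "matrix_box P e (J \<inter> A n) (ext c) = matrix_box P e (J \<inter> A n) (e x)"
        by (rule matrix_box_cong)
      also have "\<dots> \<subseteq> ?X closure_of Q n" by (rule A(2)[OF J])
      finally have "g ` matrix_box P e (J \<inter> A n) (ext c) \<subseteq> g ` (?X closure_of Q n)" by (rule image_mono)
      also have "\<dots> \<subseteq> K closure_of (g ` Q n)" by (rule continuous_map_image_closure_subset[OF g])
      finally have "K closure_of (g ` matrix_box P e (J \<inter> A n) (ext c)) \<subseteq> K closure_of (g ` Q n)"
        by (simp add: closure_of_minimal)
      moreover have "q c \<in> K closure_of (g ` matrix_box P e (J \<inter> A n) (ext c))"
        using G(1)[of "J \<inter> A n" "ext c"] J(1) by (simp add: q_def)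
      ultimately have "f (q c) \<in> f ` (K closure_of (g ` Q n))" by blast
      also have "\<dots> \<subseteq> M closure_of (f ` g ` Q n)" by (rule continuous_map_image_closure_subset[OF f])
      also have "\<dots> \<subseteq> M closure_of B n" by (intro closure_of_mono) (auto simp: Q_def)
      finally show False using notin by blast
    qed
    then show ?thesis by (metis rangeI image_eqI)
  qed
  have "compactin K (range q)"
    using image_compactin[OF _ q, of UNIV] compact_space_cantor_cube by (simp add: compact_space_def)
  then have "compactin M (f ` range q)" using f image_compactin by blast
  then have cl: "closedin M (f ` range q)" using HM compactin_imp_closedin by blast
  have "topspace M - f ` range q = {}"
  proof (rule ccontr)
    assume "topspace M - f ` range q \<noteq> {}"
    moreover have "openin M (topspace M - f ` range q)" using cl by blast
    ultimately obtain x where "x \<in> P" "f (g x) \<in> topspace M - f ` range q" using dense by metis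
    then show False using hit by blast
  qed
  then have "f ` range q = topspace M" using closedin_subset[OF cl] by blast
  then show ?thesis using q by blast
qed

section \<open>Baireness over the test space and \<pi>-monolithicity\<close>

lemma saturated_matrix_infinite:
  assumes "saturated_matrix P e"
  shows "infinite P"
proof
  assume P: "finite P"
  then obtain i where i: "\<forall>x\<in>P. e x i = True"
    using saturated_matrix_column[OF assms countable_finite, of P "\<lambda>_. True"] by blast
  obtain x where "x \<in> P" "\<forall>j\<in>{i}. e x j = False"
    using saturated_matrix_row[OF assms, of "{i}" "\<lambda>_. False"] by auto
  with i show False by simp
qed

lemma pi_monolithic_space_compact_metrizable:
  assumes "compact_space K" "metrizable_space K"
  shows "pi_monolithic_space K"
  unfolding pi_monolithic_space_def
proof (intro allI impI, elim conjE)
  fix M :: "'a topology" and f assume "f ` topspace K = topspace M"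
  then show "\<exists>T. compactin K T \<and> metrizable_space (subtopology K T) \<and> f ` T = topspace M"
    using assms by (intro exI[of _ "topspace K"]) (auto simp: compact_space_def)
qed

text \<open>The sufficiency theorem is applied with the two-point space itself as target, since it
  is compact metrizable and thus \<pi>-monolithic.\<close>

lemma Baire_Cp_matrix_space_two_point:
  assumes "saturated_matrix P e"
  shows "Baire_space (Cp (matrix_space P e) two_point_space)"
proof (rule interpolating_imp_Baire_Cp)
  show "quasi_totally_disconnected_space (matrix_space P e)"
    using assms by (rule matrix_space_quasi_totally_disconnected)
  show "interpolating (topspace (matrix_space P e)) {f. continuous_map (matrix_space P e) two_point_space f}"
    using matrix_space_interpolating[OF assms] by simp
  have "compact_space two_point_space"
    by (simp add: compact_space_discrete_topology)
  then show "compact_Hausdorff_space two_point_space" "pi_monolithic_space two_point_space"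
    by (simp_all add: compact_Hausdorff_space_def pi_monolithic_space_compact_metrizable
        Hausdorff_space_discrete_topology metrizable_space_discrete_topology)
qed

text \<open>The maps \<open>g\<close> for which \<open>f\<close> after \<open>g\<close> meets a
  given base set of \<open>M\<close> form a dense open set: \<open>P\<close> is infinite, so a point
  free of finitely many constraints can be sent into the preimage. Baireness yields one
  \<open>g\<close> meeting all base sets, hence with dense image in \<open>M\<close>, and the
  resulting Cantor image in \<open>K\<close> is the metrizable set sought.\<close>

lemma Baire_Cp_matrix_space_imp_pi_monolithic:
  fixes K :: "'k topology" and e :: "'x \<Rightarrow> 'i \<Rightarrow> bool"
  assumes e: "saturated_matrix P e" and K: "compact_Hausdorff_space K"
    and Baire: "Baire_space (Cp (matrix_space P e) K)"
  shows "pi_monolithic_space K"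
  unfolding pi_monolithic_space_def
proof (intro allI impI, elim conjE)
  fix M :: "'k topology" and f
  assume M: "compact_space M" "metrizable_space M"
    and f: "continuous_map K M f" "f ` topspace K = topspace M"
  have HK: "Hausdorff_space K" using K by (simp add: compact_Hausdorff_space_def)
  let ?X = "matrix_space P e"
  have X: "quasi_totally_disconnected_space ?X"
    using e by (rule matrix_space_quasi_totally_disconnected)
  show "\<exists>T. compactin K T \<and> metrizable_space (subtopology K T) \<and> f ` T = topspace M"
  proof (cases "topspace M = {}")
    case True
    have "metrizable_space (subtopology K {})" by (simp add: empty_metrizable_space)
    then show ?thesis using True by (intro exI[of _ "{}"]) auto
  next
    case False
    then obtain k0 where k0: "k0 \<in> topspace K" using f(2) by blast
    obtain B where B: "base_sequence M B"
      using compact_metrizable_base_sequence[OF M] by blast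
    \<comment> \<open>A base sequence may list the empty set, for which the second alternative could
      never hold.\<close>
    define U where "U n = {g \<in> topspace (Cp ?X K). B n = {} \<or> (\<exists>x\<in>P. f (g x) \<in> B n)}" for n
    have Uo: "openin (Cp ?X K) (U n)" for n
    proof (cases "B n = {}")
      case True
      then show ?thesis by (simp add: U_def)
    next
      case False
      let ?V = "{k \<in> topspace K. f k \<in> B n}"
      have "g x \<in> topspace K" if "g \<in> topspace (Cp ?X K)" "x \<in> P" for g x
        using that by (auto simp: topspace_Cp continuous_map_def)
      then have "U n = (\<Union>x\<in>P. Cp_box ?X K {x} (\<lambda>_. ?V))"
        using False by (auto simp: U_def Cp_box_def)
      moreover have "openin K ?V"
        using openin_continuous_map_preimage[OF f(1) base_sequence_openin[OF B]] .
      then have "openin (Cp ?X K) (Cp_box ?X K {x} (\<lambda>_. ?V))" if "x \<in> P" for x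
        using that by (intro openin_Cp_box) auto
      ultimately show ?thesis by auto
    qed
    have Ud: "Cp ?X K closure_of U n = topspace (Cp ?X K)" for n
      unfolding dense_intersects_open
    proof (intro allI impI)
      fix T assume T: "openin (Cp ?X K) T \<and> T \<noteq> {}"
      then obtain g0 where g0: "g0 \<in> T" by blast
      obtain D V where D: "finite D" "D \<subseteq> topspace ?X" "\<forall>x\<in>D. openin K (V x)"
          "g0 \<in> Cp_box ?X K D V" "Cp_box ?X K D V \<subseteq> T"
        using openin_Cp_contains_box[of ?X K T g0] T g0 by metis
      have g0K: "g0 x \<in> topspace K" if "x \<in> D" for x
        using D(2,4) that by (auto simp: Cp_box_def topspace_Cp continuous_map_def)
      have "\<exists>k. k \<in> topspace K \<and> (B n \<noteq> {} \<longrightarrow> f k \<in> B n)"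
      proof (cases "B n = {}")
        case False
        then obtain y where y: "y \<in> B n" by blast
        then have "y \<in> topspace M" using base_sequence_openin[OF B] openin_subset by blast
        then show ?thesis using y f(2) by (metis imageE)
      qed (use k0 in auto)
      then obtain k where k: "k \<in> topspace K" "B n \<noteq> {} \<longrightarrow> f k \<in> B n" by blast
      obtain x where x: "x \<in> P" "x \<notin> D"
        using saturated_matrix_infinite[OF e] D(1) by (meson finite_subset subsetI)
      have "\<exists>g\<in>topspace (Cp ?X K). \<forall>w\<in>insert x D. g w = (if w = x then k else g0 w)"
        by (rule Cp_extension_finite[OF X _ _ _ k0]) (use D x k(1) g0K in auto)
      then obtain g where g: "g \<in> topspace (Cp ?X K)"
          "\<forall>w\<in>insert x D. g w = (if w = x then k else g0 w)" by blast
      have "g x = k" using g(2) by simp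
      then have "g \<in> U n" using g(1) k(2) x(1) by (auto simp: U_def)
      moreover have "g w = g0 w" if "w \<in> D" for w
        using g(2) that x(2) by auto
      then have "g \<in> Cp_box ?X K D V" using D(4) g(1) by (simp add: Cp_box_def)
      then have "g \<in> T" using D(5) by blast
      ultimately show "U n \<inter> T \<noteq> {}" by blast
    qed
    have dense: "Cp ?X K closure_of (\<Inter>n. U n) = topspace (Cp ?X K)"
      by (rule Baire[unfolded Baire_space_def, rule_format]) (simp add: Uo Ud)
    have "\<exists>g\<in>topspace (Cp ?X K). \<forall>x\<in>{}. g x = k0"
      by (rule Cp_extension_finite[OF X _ _ _ k0]) auto
    then have "topspace (Cp ?X K) \<noteq> {}" by blast
    then have "(\<Inter>n. U n) \<noteq> {}" using dense by (metis closure_of_empty)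
    then obtain g where g: "\<And>n. g \<in> U n" by blast
    have gc: "continuous_map ?X K g" using g[of 0] by (simp add: U_def topspace_Cp)
    have "\<exists>x\<in>P. f (g x) \<in> V" if V: "openin M V" "V \<noteq> {}" for V
    proof -
      obtain y where y: "y \<in> V" using V(2) by blast
      obtain n where n: "y \<in> B n" "B n \<subseteq> V" using base_sequenceD[OF B V(1) y] by blast
      have "\<exists>x\<in>P. f (g x) \<in> B n" using g[of n] n(1) by (auto simp: U_def)
      then show ?thesis using n(2) by blast
    qed
    then obtain q :: "(nat \<Rightarrow> bool) \<Rightarrow> 'k"
      where q: "continuous_map cantor_cube K q" "f ` range q = topspace M"
      using matrix_space_dense_image_covered[OF e K gc M f(1)] by metis
    let ?S = "subtopology K (range q)"
    have qK: "range q \<subseteq> topspace K" using q(1) by (simp add: continuous_map_cantor_cube_iff)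
    have "compactin K (range q)"
      using image_compactin[OF _ q(1), of UNIV] compact_space_cantor_cube
      by (simp add: compact_space_def)
    moreover have "metrizable_space ?S"
    proof (rule metrizable_Hausdorff_cantor_image)
      show "continuous_map cantor_cube ?S q" using q(1) by (simp add: continuous_map_in_subtopology)
      show "range q = topspace ?S" using qK by auto
      show "Hausdorff_space ?S" using HK Hausdorff_space_subtopology by blast
    qed
    ultimately show ?thesis using q(2) by blast
  qed
qed

theorem theorem3p12:
  shows "(pi_monolithic_compacta :: 'k topology set) \<subseteq> Cp_Baire_compacta TYPE('x) \<and>
    ((UNIV :: real set) \<lesssim> (UNIV :: 'x set) \<longrightarrow>
      (Cp_Baire_compacta TYPE('x) :: 'k topology set) = pi_monolithic_compacta)"
proof (intro conjI impI)
  show sub: "(pi_monolithic_compacta :: 'k topology set) \<subseteq> Cp_Baire_compacta TYPE('x)"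
    unfolding pi_monolithic_compacta_def Cp_Baire_compacta_def
    using interpolating_imp_Baire_Cp Baire_Cp_imp_interpolating by blast
  assume "(UNIV :: real set) \<lesssim> (UNIV :: 'x set)"
  \<comment> \<open>The matrix has binary sequences as rows; through sets of naturals these inject
    into any type with at least continuum many elements.\<close>
  then have "(UNIV :: nat set set) \<lesssim> (UNIV :: 'x set)"
    using nat_sets_eqpoll_reals by (meson eqpoll_imp_lepoll lepoll_trans)
  then obtain j :: "nat set \<Rightarrow> 'x" where "inj j"
    by (auto simp: lepoll_def)
  then have \<iota>: "inj (\<lambda>r. j (Collect r))"
    by (auto simp: inj_on_def)
  obtain e0 :: "(nat \<Rightarrow> bool) \<Rightarrow> (nat \<Rightarrow> bool) \<Rightarrow> bool" where e0: "saturated_matrix UNIV e0"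
    using saturated_matrix_exists by blast
  \<comment> \<open>A single test space, chosen before \<open>K\<close>, detects every failure of
    \<pi>-monolithicity.\<close>
  obtain P and e :: "'x \<Rightarrow> (nat \<Rightarrow> bool) \<Rightarrow> bool" where e: "saturated_matrix P e"
    using saturated_matrix_inj_image[OF e0 \<iota>] by blast
  have "K \<in> pi_monolithic_compacta" if K: "K \<in> Cp_Baire_compacta TYPE('x)" for K :: "'k topology"
  proof -
    have "Baire_space (Cp (matrix_space P e) K)" "compact_Hausdorff_space K"
      using K matrix_space_tychonoff[OF e] matrix_space_quasi_totally_disconnected[OF e]
        Baire_Cp_matrix_space_two_point[OF e]
      by (auto simp: Cp_Baire_compacta_def)
    then show ?thesis
      using Baire_Cp_matrix_space_imp_pi_monolithic[OF e] by (simp add: pi_monolithic_compacta_def)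
  qed
  with sub show "(Cp_Baire_compacta TYPE('x) :: 'k topology set) = pi_monolithic_compacta"
    by blast
qed

end
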